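(* Fix $\alpha\in(0,1]$ and $\delta>0$. Consider the symmetric two-user IM/DD interference channel with $h_{11}=h_{22}=1$, $h_{12}=h_{21}=g$, $\alpha_1=\alpha_2=\alpha$, where the cross gain is tied to the peak-to-noise ratio by $g=\left(\frac{\mathsf{A}}{\sigma}\right)^{\delta-1}$ (equivalently $\delta=\frac{\log(g\mathsf{A}/\sigma)}{\log(\mathsf{A}/\sigma)}$). Define the generalized degrees of freedom $$\gamma(\delta)=\lim_{\frac{\mathsf{A}}{\sigma}\to\infty}\frac{\mathsf{C}_{\rm sum}}{2\log\left(\frac{\mathsf{A}}{\sigma}\right)}.$$ Then $$\gamma(\delta)=\min\Big\{\max\{1-\delta,\delta\},\ \max\{1-\tfrac{\delta}{2},\tfrac{\delta}{2}\},\ 1\Big\}.$$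
   Context: Two-user IM/DD interference channel: for $i,j\in\{1,2\}$, $i\neq j$, at each time instant $Y_i=h_{ii}X_i+h_{ji}X_j+Z_i$, where $h_{kl}\ge 0$ are channel gains, the noises $Z_1,Z_2$ are $\mathcal{N}(0,\sigma^2)$ ($\sigma>0$), i.i.d. over time and independent of the inputs. Each input must satisfy $X_i\in[0,\mathsf{A}]$ (peak constraint, $\mathsf{A}>0$) and $\mathbb{E}[X_i]\le\alpha_i\mathsf{A}$ with $\alpha_i\in(0,1]$. Transmitter $i$ encodes a message $m_i\in\{1,\dots,\lceil 2^{n\mathsf{R}_i}\rceil\}$ into a length-$n$ codeword whose symbols satisfy these constraints; receiver $i$ decodes $m_i$ from $Y_i^n$. A rate pair $(\mathsf{R}_1,\mathsf{R}_2)$ is achievable if there exist codes whose average error probabilities at both receivers tend to $0$ as $n\to\infty$. The capacity region $\mathcal{G}$ is the closure of the set of achievable rate pairs, and $\mathsf{C}_{\rm sum}=\max_{(\mathsf{R}_1,\mathsf{R}_2)\in\mathcal{G}}(\mathsf{R}_1+\mathsf{R}_2)$. All logarithms are base 2. *)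

theory Defs
  imports "HOL-Probability.Probability"
begin

text \<open>Two-user IM/DD interference channel. Channel gains are passed in the order
  h11 h12 h21 h22; receiver 1 sees Y1 = h11 X1 + h21 X2 + Z1, receiver 2 sees
  Y2 = h22 X2 + h12 X1 + Z2, with Z_i i.i.d. N(0, sigma^2) over time.\<close>

definition msg_num :: "real \<Rightarrow> nat \<Rightarrow> nat" where
  "msg_num R n = nat \<lceil>2 powr (real n * R)\<rceil>"

definition noise_meas :: "real \<Rightarrow> nat \<Rightarrow> (nat \<Rightarrow> real) measure" where
  "noise_meas \<sigma> n = PiM {..<n} (\<lambda>_. density lborel (normal_density 0 \<sigma>))"

text \<open>Encoder: f m t is the symbol sent at time t < n for message m in {1..M};
  peak constraint 0 <= x <= A and average constraint (1/n) sum_t x_t <= a * A per codeword.\<close>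
definition valid_encoder :: "real \<Rightarrow> real \<Rightarrow> nat \<Rightarrow> nat \<Rightarrow> (nat \<Rightarrow> nat \<Rightarrow> real) \<Rightarrow> bool" where
  "valid_encoder A a n M f \<longleftrightarrow>
     (\<forall>m\<in>{1..M}. (\<forall>t<n. 0 \<le> f m t \<and> f m t \<le> A) \<and> (\<Sum>t<n. f m t) \<le> real n * (a * A))"

definition valid_decoder :: "nat \<Rightarrow> ((nat \<Rightarrow> real) \<Rightarrow> nat) \<Rightarrow> bool" where
  "valid_decoder n \<phi> \<longleftrightarrow> \<phi> \<in> measurable (PiM {..<n} (\<lambda>_. borel)) (count_space UNIV)"

definition err_prob :: "real \<Rightarrow> nat \<Rightarrow> real \<Rightarrow> real \<Rightarrow> nat \<Rightarrow> nat \<Rightarrow>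
    (nat \<Rightarrow> nat \<Rightarrow> real) \<Rightarrow> (nat \<Rightarrow> nat \<Rightarrow> real) \<Rightarrow> ((nat \<Rightarrow> real) \<Rightarrow> nat) \<Rightarrow> real" where
  "err_prob \<sigma> n hown hint M K f g \<phi> =
     (\<Sum>m\<in>{1..M}. \<Sum>k\<in>{1..K}.
        measure (noise_meas \<sigma> n)
          {z \<in> space (noise_meas \<sigma> n). \<phi> (\<lambda>t\<in>{..<n}. hown * f m t + hint * g k t + z t) \<noteq> m})
     / (real M * real K)"

definition achievable ::
  "real \<Rightarrow> real \<Rightarrow> real \<Rightarrow> real \<Rightarrow> real \<Rightarrow> real \<Rightarrow> real \<Rightarrow> real \<Rightarrow> real \<times> real \<Rightarrow> bool" where
  "achievable h11 h12 h21 h22 a1 a2 A \<sigma> R \<longleftrightarrow>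
     (\<exists>(f1 :: nat \<Rightarrow> nat \<Rightarrow> nat \<Rightarrow> real) (f2 :: nat \<Rightarrow> nat \<Rightarrow> nat \<Rightarrow> real)
        (\<phi>1 :: nat \<Rightarrow> (nat \<Rightarrow> real) \<Rightarrow> nat) (\<phi>2 :: nat \<Rightarrow> (nat \<Rightarrow> real) \<Rightarrow> nat).
       (\<forall>n. valid_encoder A a1 n (msg_num (fst R) n) (f1 n) \<and>
            valid_encoder A a2 n (msg_num (snd R) n) (f2 n) \<and>
            valid_decoder n (\<phi>1 n) \<and> valid_decoder n (\<phi>2 n)) \<and>
       (\<lambda>n. err_prob \<sigma> n h11 h21 (msg_num (fst R) n) (msg_num (snd R) n) (f1 n) (f2 n) (\<phi>1 n))
          \<longlonglongrightarrow> 0 \<and>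
       (\<lambda>n. err_prob \<sigma> n h22 h12 (msg_num (snd R) n) (msg_num (fst R) n) (f2 n) (f1 n) (\<phi>2 n))
          \<longlonglongrightarrow> 0)"

definition capacity_region ::
  "real \<Rightarrow> real \<Rightarrow> real \<Rightarrow> real \<Rightarrow> real \<Rightarrow> real \<Rightarrow> real \<Rightarrow> real \<Rightarrow> (real \<times> real) set" where
  "capacity_region h11 h12 h21 h22 a1 a2 A \<sigma> =
     closure {R. achievable h11 h12 h21 h22 a1 a2 A \<sigma> R}"

definition sum_capacity ::
  "real \<Rightarrow> real \<Rightarrow> real \<Rightarrow> real \<Rightarrow> real \<Rightarrow> real \<Rightarrow> real \<Rightarrow> real \<Rightarrow> real" where
  "sum_capacity h11 h12 h21 h22 a1 a2 A \<sigma> =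
     Sup ((\<lambda>R. fst R + snd R) ` capacity_region h11 h12 h21 h22 a1 a2 A \<sigma>)"

end

theory Submission
  imports Defs
begin

text \<open>
  Rates are measured in units of log 2 P, where P = A / sigma, up to additive constants.

  Converse. A Gaussian centred at x is dominated, up to a constant factor per symbol, by a wider Gaussian
  centred at a grid point within distance sigma of x. Hence the probability of correct decoding is at most
  c^n times that of a randomized decoder which only sees integer vectors, and bounding it becomes counting:
  the entropy inequalities of the usual genie arguments turn into counting inequalities for sums of
  probabilities of correct decoding. For the two-sided genie, where entropies have to cancel between the
  receivers, the substitute for the cancellation is a weighted Cauchy--Schwarz inequality.

  Achievability. Each codeword is the sum of a coarse word of amplitude of order A, and a detail word
  of amplitude of order sigma * P powr (1 - delta), which arrives below the noise level at the other receiver.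
  All words are uniformly random on a grid. The receiver looks for its own message and a coarse word of the other user
  that explain all but a small fraction of the received symbols. A wrong pair explains one symbol only
  with a probability of order P powr (- x), where x depends on which of the words are wrong, and the union
  bounds over the kinds of confusion are exactly the constraints that define the W-shaped curve.
\<close>

section \<open>Gaussian noise and quantized observations\<close>

text \<open>Only exponents of P survive the limit, so factors \<open>c ^ n\<close> with c
  independent of P are affordable on both sides: they shift rates by a bounded amount. This permits
  crude quantization, union bounds over sets of positions, and a decoder that ignores some symbols.
  The last tolerance is forced: whatever the threshold, a positive fraction of the noise samples
  tends to exceed it, so a fraction \<eta> of failures is accepted. It costs the share 2 \<eta> of
  the rate, and the threshold depends on \<eta>; hence \<eta> is fixed first, P then grows, and the
  gap closes because \<eta> is arbitrary. In the two-sided converse the interference classes of a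
  codebook may have very unequal sizes, so no single number can play the role of an entropy.
  Weighting each pair of messages by the ratio of its own class sizes makes the cancellation
  pointwise. The code is a Han-Kobayashi splitting whose detail level is set by the noise floor of
  the other receiver. A wrong guess of the interfering coarse word does no harm if the own message
  is right, so the decoder does not ask for that word to be unique.\<close>

lemma normal_density_dominated:
  assumes "\<bar>x - \<mu>\<bar> \<le> \<sigma>" "0 < \<sigma>"
  shows "normal_density x \<sigma> y \<le> sqrt (2 * exp 1) * normal_density \<mu> (sqrt 2 * \<sigma>) y"
proof -
  \<comment> \<open>From (p + q)^2 \<le> 2 p^2 + 2 q^2. The factor 2 in front of (y - x)^2 is why
    the dominating density has its variance doubled; the shift by at most \<sigma> costs exp (1/2),
    the normalization sqrt 2.\<close>
  have "(y - \<mu>)\<^sup>2 \<le> 2 * (y - x)\<^sup>2 + 2 * (x - \<mu>)\<^sup>2"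
    using zero_le_power2[of "(y - x) - (x - \<mu>)"] by (simp add: power2_eq_square algebra_simps)
  moreover have "(x - \<mu>)\<^sup>2 \<le> \<sigma>\<^sup>2"
    using assms by (metis abs_le_square_iff abs_of_pos)
  ultimately have "(y - \<mu>)\<^sup>2 \<le> 2 * (y - x)\<^sup>2 + 2 * \<sigma>\<^sup>2" by linarith
  then have "- ((y - x)\<^sup>2) / (2 * \<sigma>\<^sup>2) \<le> 1/2 + (- (y - \<mu>)\<^sup>2 / (2 * (sqrt 2 * \<sigma>)\<^sup>2))"
    using assms(2) by (simp add: field_simps)
  then have "exp (- ((y - x)\<^sup>2) / (2 * \<sigma>\<^sup>2)) \<le> exp (1/2) * exp (- (y - \<mu>)\<^sup>2 / (2 * (sqrt 2 * \<sigma>)\<^sup>2))"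
    by (simp add: exp_add[symmetric])
  then have "normal_density x \<sigma> y \<le> 1 / sqrt (2 * pi * \<sigma>\<^sup>2) * (exp (1/2) * exp (- (y - \<mu>)\<^sup>2 / (2 * (sqrt 2 * \<sigma>)\<^sup>2)))"
    unfolding normal_density_def using assms(2) by (intro mult_left_mono) auto
  also have "\<dots> = sqrt (2 * exp 1) * normal_density \<mu> (sqrt 2 * \<sigma>) y"
  proof -
    have "sqrt (exp 1) = exp (1/2 :: real)"
      by (rule real_sqrt_unique) (simp_all add: power2_eq_square exp_add[symmetric])
    moreover have "sqrt (2 * pi * (sqrt 2 * \<sigma>)\<^sup>2) = sqrt 2 * sqrt (2 * pi * \<sigma>\<^sup>2)"
      by (simp add: power_mult_distrib real_sqrt_mult[symmetric] mult_ac)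
    ultimately show ?thesis
      unfolding normal_density_def by (simp add: real_sqrt_mult)
  qed
  finally show ?thesis .
qed

abbreviation gaussian :: "real \<Rightarrow> real \<Rightarrow> real measure" where
  "gaussian \<mu> \<sigma> \<equiv> density lborel (normal_density \<mu> \<sigma>)"

lemma nn_integral_gaussian_shift_dominated:
  assumes "\<bar>x - \<mu>\<bar> \<le> \<sigma>" "0 < \<sigma>" and [measurable]: "f \<in> borel_measurable borel"
  shows "(\<integral>\<^sup>+z. f (x + z) \<partial>gaussian 0 \<sigma>)
    \<le> ennreal (sqrt (2 * exp 1)) * (\<integral>\<^sup>+y. f y \<partial>gaussian \<mu> (sqrt 2 * \<sigma>))"
proof -
  have "(\<integral>\<^sup>+z. f (x + z) \<partial>gaussian 0 \<sigma>) = (\<integral>\<^sup>+z. normal_density 0 \<sigma> z * f (x + z) \<partial>lborel)"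
    by (subst nn_integral_density) auto
  also have "\<dots> = (\<integral>\<^sup>+z. normal_density x \<sigma> z * f z \<partial>distr lborel borel ((+) x))"
    by (subst nn_integral_distr) (auto simp: normal_density_def)
  also have "\<dots> = (\<integral>\<^sup>+z. normal_density x \<sigma> z * f z \<partial>lborel)"
    by (simp add: lborel_distr_plus)
  also have "\<dots> \<le> (\<integral>\<^sup>+z. ennreal (sqrt (2 * exp 1)) * (normal_density \<mu> (sqrt 2 * \<sigma>) z * f z) \<partial>lborel)"
  proof (intro nn_integral_mono)
    fix z
    have "ennreal (normal_density x \<sigma> z)
      \<le> ennreal (sqrt (2 * exp 1)) * ennreal (normal_density \<mu> (sqrt 2 * \<sigma>) z)"
      using normal_density_dominated[OF assms(1,2), of z]
      by (simp add: ennreal_mult[symmetric] ennreal_leI)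
    then show "normal_density x \<sigma> z * f z
      \<le> ennreal (sqrt (2 * exp 1)) * (normal_density \<mu> (sqrt 2 * \<sigma>) z * f z)"
      by (metis mult.assoc mult_right_mono zero_le)
  qed
  also have "\<dots> = ennreal (sqrt (2 * exp 1)) * (\<integral>\<^sup>+z. normal_density \<mu> (sqrt 2 * \<sigma>) z * f z \<partial>lborel)"
    by (subst nn_integral_cmult) auto
  also have "\<dots> = ennreal (sqrt (2 * exp 1)) * (\<integral>\<^sup>+y. f y \<partial>gaussian \<mu> (sqrt 2 * \<sigma>))"
    by (subst nn_integral_density) auto
  finally show ?thesis .
qed

lemma product_prob_space_gaussian:
  assumes "0 < \<sigma>" shows "product_prob_space (\<lambda>i. gaussian (\<mu> i) \<sigma>)"
proof -
  interpret prob_space "gaussian (\<mu> i) \<sigma>" for i by (rule prob_space_normal_density[OF assms])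
  show ?thesis ..
qed

lemma sets_PiM_gaussian: "sets (PiM I (\<lambda>i. gaussian (\<mu> i) \<sigma>)) = sets (PiM I (\<lambda>_. borel))"
  by (intro sets_PiM_cong) auto

lemma shift_measurable:
  "(\<lambda>z. \<lambda>t\<in>I. x t + z t) \<in> PiM I (\<lambda>i. gaussian (\<mu> i) \<sigma>) \<rightarrow>\<^sub>M PiM I (\<lambda>_. borel)"
proof (rule measurable_restrict)
  fix i assume "i \<in> I"
  then have "(\<lambda>z. z i) \<in> PiM I (\<lambda>i. gaussian (\<mu> i) \<sigma>) \<rightarrow>\<^sub>M gaussian (\<mu> i) \<sigma>"
    by (rule measurable_component_singleton)
  then show "(\<lambda>z. x i + z i) \<in> borel_measurable (PiM I (\<lambda>i. gaussian (\<mu> i) \<sigma>))"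
    by simp
qed

text \<open>Functions instead of events: the induction hypothesis is applied to \<open>?g\<close>,
  the integral of \<open>f\<close> over the new coordinate, which need not be an indicator even if
  \<open>f\<close> is one.\<close>

lemma nn_integral_PiM_gaussian_shift_dominated:
  assumes "finite I" "0 < \<sigma>" "\<And>i. i \<in> I \<Longrightarrow> \<bar>x i - \<mu> i\<bar> \<le> \<sigma>"
    and "f \<in> borel_measurable (PiM I (\<lambda>_. borel))"
  shows "(\<integral>\<^sup>+z. f (\<lambda>i\<in>I. x i + z i) \<partial>PiM I (\<lambda>_. gaussian 0 \<sigma>))
    \<le> ennreal (sqrt (2 * exp 1)) ^ card I * (\<integral>\<^sup>+y. f y \<partial>PiM I (\<lambda>i. gaussian (\<mu> i) (sqrt 2 * \<sigma>)))"
  using assms(1,3,4)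
proof (induction I arbitrary: f rule: finite_induct)
  case empty
  then show ?case by (simp add: PiM_empty nn_integral_count_space_finite)
next
  case (insert i I)
  interpret M: product_prob_space "\<lambda>_. gaussian 0 \<sigma>"
    by (rule product_prob_space_gaussian) fact
  interpret N: product_prob_space "\<lambda>i. gaussian (\<mu> i) (sqrt 2 * \<sigma>)"
    by (rule product_prob_space_gaussian) (use assms in simp)
  let ?C = "ennreal (sqrt (2 * exp 1))"
  let ?M = "\<lambda>_. gaussian 0 \<sigma>" and ?N = "\<lambda>i. gaussian (\<mu> i) (sqrt 2 * \<sigma>)"
  let ?g = "\<lambda>w. \<integral>\<^sup>+y. f (w(i := y)) \<partial>?N i"
  note f[measurable] = insert.prems(2)
  have fN: "f \<in> borel_measurable (PiM (insert i I) ?N)"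
    using f by (subst measurable_cong_sets[OF sets_PiM_gaussian refl])
  have shift: "(\<lambda>z. f (\<lambda>k\<in>insert i I. x k + z k)) \<in> borel_measurable (PiM (insert i I) ?M)"
    by (rule measurable_compose[OF shift_measurable f])
  have upd: "(\<lambda>(w, y). f (w(i := y))) \<in> borel_measurable (PiM I (\<lambda>_. borel) \<Otimes>\<^sub>M ?N i)"
  proof -
    have "(\<lambda>p. f ((\<lambda>(w, y). w(i := y)) p)) \<in> borel_measurable (PiM I (\<lambda>_. borel) \<Otimes>\<^sub>M borel)"
      using measurable_add_dim f by (rule measurable_compose)
    moreover have "sets (PiM I (\<lambda>_. borel) \<Otimes>\<^sub>M ?N i) = sets (PiM I (\<lambda>_. borel) \<Otimes>\<^sub>M borel)"
      by (intro sets_pair_measure_cong) auto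
    ultimately show ?thesis
      by (simp add: case_prod_unfold cong: measurable_cong_sets)
  qed
  have g: "?g \<in> borel_measurable (PiM I (\<lambda>_. borel))"
    using N.sigma_finite_measures upd
    by (intro sigma_finite_measure.borel_measurable_nn_integral) auto
  have "(\<integral>\<^sup>+z. f (\<lambda>k\<in>insert i I. x k + z k) \<partial>PiM (insert i I) ?M)
    = (\<integral>\<^sup>+w. (\<integral>\<^sup>+y. f (\<lambda>k\<in>insert i I. x k + (w(i := y)) k) \<partial>?M i) \<partial>PiM I ?M)"
    using insert.hyps shift by (rule M.product_nn_integral_insert)
  also have "\<dots> = (\<integral>\<^sup>+w. (\<integral>\<^sup>+y. f ((\<lambda>k\<in>I. x k + w k)(i := x i + y)) \<partial>?M i) \<partial>PiM I ?M)"
  proof (intro nn_integral_cong arg_cong[of _ _ f])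
    fix w y show "(\<lambda>k\<in>insert i I. x k + (w(i := y)) k) = (\<lambda>k\<in>I. x k + w k)(i := x i + y)"
      using insert.hyps(2) by (auto simp: fun_eq_iff)
  qed
  also have "\<dots> \<le> (\<integral>\<^sup>+w. ?C * ?g (\<lambda>k\<in>I. x k + w k) \<partial>PiM I ?M)"
  proof (intro nn_integral_mono)
    fix w assume w: "w \<in> space (PiM I ?M)"
    have "(\<lambda>k\<in>I. x k + w k) \<in> space (PiM I (\<lambda>_. borel :: real measure))"
      by (auto simp: space_PiM)
    from measurable_compose[OF measurable_Pair1'[OF this, where ?M2.0=borel]
        measurable_compose[OF measurable_add_dim f]]
    have "(\<lambda>y. f ((\<lambda>k\<in>I. x k + w k)(i := y))) \<in> borel_measurable borel"
      by simp
    from nn_integral_gaussian_shift_dominated[OF insert.prems(1)[OF insertI1] assms(2) this]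
    show "(\<integral>\<^sup>+y. f ((\<lambda>k\<in>I. x k + w k)(i := x i + y)) \<partial>?M i) \<le> ?C * ?g (\<lambda>k\<in>I. x k + w k)"
      by simp
  qed
  also have "\<dots> = ?C * (\<integral>\<^sup>+w. ?g (\<lambda>k\<in>I. x k + w k) \<partial>PiM I ?M)"
  proof (rule nn_integral_cmult)
    from measurable_compose[OF shift_measurable g]
    show "(\<lambda>w. ?g (\<lambda>k\<in>I. x k + w k)) \<in> borel_measurable (PiM I ?M)" by simp
  qed
  also have "\<dots> \<le> ?C * (?C ^ card I * (\<integral>\<^sup>+w. ?g w \<partial>PiM I ?N))"
    by (rule mult_left_mono[OF insert.IH[OF insert.prems(1)[OF insertI2] g]]) simp_all
  also have "(\<integral>\<^sup>+w. ?g w \<partial>PiM I ?N) = (\<integral>\<^sup>+y. f y \<partial>PiM (insert i I) ?N)"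
    using insert.hyps fN by (rule N.product_nn_integral_insert[symmetric])
  finally show ?case
    using insert.hyps by (simp add: mult_ac)
qed

section \<open>Correct decoding from noisy and from quantized observations\<close>

lemma prob_space_noise_meas: "0 < \<sigma> \<Longrightarrow> prob_space (noise_meas \<sigma> n)"
  unfolding noise_meas_def
  by (intro prob_space_PiM prob_space_normal_density)

definition success :: "real \<Rightarrow> nat \<Rightarrow> (nat \<Rightarrow> real) \<Rightarrow> ((nat \<Rightarrow> real) \<Rightarrow> nat) \<Rightarrow> nat \<Rightarrow> real" where
  "success \<sigma> n x \<phi> m =
     measure (noise_meas \<sigma> n) {z \<in> space (noise_meas \<sigma> n). \<phi> (\<lambda>t\<in>{..<n}. x t + z t) = m}"

text \<open>For a fixed integer vector \<open>d\<close> these numbers add up to at most 1 over the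
  messages: they describe a randomized decoder that sees only \<open>d\<close>. The doubled variance
  is the one that dominates all inputs within \<sigma> of the grid point.\<close>

definition smeared :: "real \<Rightarrow> nat \<Rightarrow> ((nat \<Rightarrow> real) \<Rightarrow> nat) \<Rightarrow> (nat \<Rightarrow> int) \<Rightarrow> nat \<Rightarrow> real" where
  "smeared \<sigma> n \<phi> d m = measure (PiM {..<n} (\<lambda>t. gaussian (\<sigma> * d t) (sqrt 2 * \<sigma>)))
     {y \<in> space (PiM {..<n} (\<lambda>_. borel)). \<phi> y = m}"

lemma decoder_measurable:
  assumes "valid_decoder n \<phi>"
  shows "{y \<in> space (PiM {..<n} (\<lambda>_. borel)). \<phi> y = m} \<in> sets (PiM {..<n} (\<lambda>_. borel))"
proof -
  have "\<phi> -` {m} \<inter> space (PiM {..<n} (\<lambda>_. borel)) \<in> sets (PiM {..<n} (\<lambda>_. borel))"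
    using assms unfolding valid_decoder_def by (rule measurable_sets) simp
  then show ?thesis by (simp add: vimage_def Int_def conj_commute)
qed

lemma received_measurable:
  "(\<lambda>z. \<lambda>t\<in>{..<n}. x t + z t) \<in> noise_meas \<sigma> n \<rightarrow>\<^sub>M PiM {..<n} (\<lambda>_. borel)"
  unfolding noise_meas_def by (rule shift_measurable)

lemma success_measurable:
  assumes "valid_decoder n \<phi>"
  shows "{z \<in> space (noise_meas \<sigma> n). \<phi> (\<lambda>t\<in>{..<n}. x t + z t) = m} \<in> sets (noise_meas \<sigma> n)"
proof -
  have "(\<lambda>z. \<phi> (\<lambda>t\<in>{..<n}. x t + z t)) \<in> noise_meas \<sigma> n \<rightarrow>\<^sub>M count_space UNIV"
    using received_measurable assms unfolding valid_decoder_def by (rule measurable_compose)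
  from measurable_sets[OF this, of "{m}"]
  have "(\<lambda>z. \<phi> (\<lambda>t\<in>{..<n}. x t + z t)) -` {m} \<inter> space (noise_meas \<sigma> n) \<in> sets (noise_meas \<sigma> n)"
    by simp
  then show ?thesis by (simp add: vimage_def Int_def conj_commute)
qed

text \<open>The factor \<open>sqrt (2 * exp 1) ^ n\<close> is the whole price of passing to integer
  observations: a constant number of bits per symbol.\<close>

lemma success_le_smeared:
  assumes "0 < \<sigma>" "valid_decoder n \<phi>" "\<And>t. t < n \<Longrightarrow> \<bar>x t - \<sigma> * d t\<bar> \<le> \<sigma>"
  shows "success \<sigma> n x \<phi> m \<le> sqrt (2 * exp 1) ^ n * smeared \<sigma> n \<phi> d m"
proof -
  let ?D = "{y \<in> space (PiM {..<n} (\<lambda>_. borel)). \<phi> y = m}"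
  let ?N = "PiM {..<n} (\<lambda>t. gaussian (\<sigma> * d t) (sqrt 2 * \<sigma>))"
  interpret noise: prob_space "noise_meas \<sigma> n" by (rule prob_space_noise_meas) fact
  interpret N: prob_space ?N
    using assms(1) by (intro prob_space_PiM prob_space_normal_density) auto
  have D: "?D \<in> sets (PiM {..<n} (\<lambda>_. borel))" by (rule decoder_measurable) fact
  have DN: "?D \<in> sets ?N" using D by (subst sets_PiM_gaussian)
  have S: "{z \<in> space (noise_meas \<sigma> n). \<phi> (\<lambda>t\<in>{..<n}. x t + z t) = m} \<in> sets (noise_meas \<sigma> n)"
    by (rule success_measurable) fact
  have "ennreal (success \<sigma> n x \<phi> m)
    = (\<integral>\<^sup>+z. indicator {z \<in> space (noise_meas \<sigma> n). \<phi> (\<lambda>t\<in>{..<n}. x t + z t) = m} z \<partial>noise_meas \<sigma> n)"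
    using S by (simp add: success_def noise.emeasure_eq_measure)
  also have "\<dots> = (\<integral>\<^sup>+z. indicator ?D (\<lambda>t\<in>{..<n}. x t + z t) \<partial>noise_meas \<sigma> n)"
    by (intro nn_integral_cong) (auto simp: indicator_def space_PiM)
  also have "\<dots> \<le> ennreal (sqrt (2 * exp 1)) ^ card {..<n} * (\<integral>\<^sup>+y. indicator ?D y \<partial>?N)"
    unfolding noise_meas_def
    using D assms by (intro nn_integral_PiM_gaussian_shift_dominated) auto
  also have "\<dots> = ennreal (sqrt (2 * exp 1) ^ n * smeared \<sigma> n \<phi> d m)"
    using DN by (simp add: smeared_def N.emeasure_eq_measure ennreal_mult ennreal_power)
  finally show ?thesis
    by (subst (asm) ennreal_le_iff) (auto simp: smeared_def)
qed

lemma smeared_nonneg: "0 \<le> smeared \<sigma> n \<phi> d m"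
  by (simp add: smeared_def)

lemma sum_smeared_le_1:
  assumes "0 < \<sigma>" "valid_decoder n \<phi>" "finite S"
  shows "(\<Sum>m\<in>S. smeared \<sigma> n \<phi> d m) \<le> 1"
proof -
  let ?N = "PiM {..<n} (\<lambda>t. gaussian (\<sigma> * d t) (sqrt 2 * \<sigma>))"
  interpret N: prob_space ?N
    using assms(1) by (intro prob_space_PiM prob_space_normal_density) auto
  have "{y \<in> space (PiM {..<n} (\<lambda>_. borel)). \<phi> y = m} \<in> sets ?N" for m
    using decoder_measurable[OF assms(2)] by (subst sets_PiM_gaussian)
  then have "(\<Sum>m\<in>S. smeared \<sigma> n \<phi> d m)
    = measure ?N (\<Union>m\<in>S. {y \<in> space (PiM {..<n} (\<lambda>_. borel)). \<phi> y = m})"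
    unfolding smeared_def using assms(3)
    by (intro N.finite_measure_finite_Union[symmetric]) (auto simp: disjoint_family_on_def)
  also have "\<dots> \<le> 1" by simp
  finally show ?thesis .
qed

lemma success_bounds: "0 < \<sigma> \<Longrightarrow> 0 \<le> success \<sigma> n x \<phi> m \<and> success \<sigma> n x \<phi> m \<le> 1"
  using prob_space.prob_le_1[OF prob_space_noise_meas] by (simp add: success_def)

lemma err_prob_eq:
  assumes "0 < \<sigma>" "valid_decoder n \<phi>" "0 < M" "0 < K"
  shows "(\<Sum>m\<in>{1..M}. \<Sum>k\<in>{1..K}. success \<sigma> n (\<lambda>t. a * f m t + b * g k t) \<phi> m)
    = (1 - err_prob \<sigma> n a b M K f g \<phi>) * (real M * real K)"
proof -
  interpret noise: prob_space "noise_meas \<sigma> n" by (rule prob_space_noise_meas) fact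
  have "measure (noise_meas \<sigma> n) {z \<in> space (noise_meas \<sigma> n).
      \<phi> (\<lambda>t\<in>{..<n}. a * f m t + b * g k t + z t) \<noteq> m}
    = 1 - success \<sigma> n (\<lambda>t. a * f m t + b * g k t) \<phi> m" for m k
    using noise.prob_neg[OF success_measurable[OF assms(2)]] unfolding success_def by simp
  then have "err_prob \<sigma> n a b M K f g \<phi> * (real M * real K)
    = (\<Sum>m\<in>{1..M}. \<Sum>k\<in>{1..K}. 1 - success \<sigma> n (\<lambda>t. a * f m t + b * g k t) \<phi> m)"
    using assms(3,4) unfolding err_prob_def by simp
  also have "\<dots> = real M * real K - (\<Sum>m\<in>{1..M}. \<Sum>k\<in>{1..K}. success \<sigma> n (\<lambda>t. a * f m t + b * g k t) \<phi> m)"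
    by (simp add: sum_subtractf)
  finally show ?thesis by (simp add: algebra_simps)
qed

section \<open>Counting bounds for correct decodings\<close>

text \<open>A counting substitute for Fano's inequality: extending the sum from the view
  \<open>a w\<close> to all views in \<open>D\<close> only increases it, and each view then
  contributes total probability at most 1.\<close>

lemma sum_decoding_le_card:
  fixes Q :: "'d \<Rightarrow> 'w \<Rightarrow> real"
  assumes "finite W" "finite D" "\<And>w. w \<in> W \<Longrightarrow> a w \<in> D"
    and Q: "\<And>d w. 0 \<le> Q d w" "\<And>d. (\<Sum>w\<in>W. Q d w) \<le> 1"
  shows "(\<Sum>w\<in>W. Q (a w) w) \<le> card D"
proof -
  have "(\<Sum>w\<in>W. Q (a w) w) \<le> (\<Sum>w\<in>W. \<Sum>d\<in>D. Q d w)"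
    using assms by (intro sum_mono member_le_sum) auto
  also have "\<dots> = (\<Sum>d\<in>D. \<Sum>w\<in>W. Q d w)" by (rule sum.swap)
  also have "\<dots> \<le> (\<Sum>d\<in>D. 1)" by (intro sum_mono Q)
  finally show ?thesis by simp
qed

text \<open>Receiver 1, once it knows its own message, only needs a side information with K values
  to see everything that receiver 2 sees.\<close>
lemma sum_decoding_one_sided_le:
  fixes Q1 :: "'d \<Rightarrow> 'u \<Rightarrow> real" and Q2 :: "'e \<Rightarrow> 'w \<Rightarrow> real" and K :: real
  assumes fin: "finite W1" "finite W2" "finite D"
    and D: "\<And>w1 w2. w1 \<in> W1 \<Longrightarrow> w2 \<in> W2 \<Longrightarrow> d w1 w2 \<in> D"
    and K: "\<And>w1 d0. w1 \<in> W1 \<Longrightarrow> real (card (e w1 ` {w2 \<in> W2. d w1 w2 = d0})) \<le> K"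
    and Q1: "\<And>d w. 0 \<le> Q1 d w" "\<And>d. (\<Sum>w\<in>W1. Q1 d w) \<le> 1"
    and Q2: "\<And>d w. 0 \<le> Q2 d w" "\<And>d. (\<Sum>w\<in>W2. Q2 d w) \<le> 1"
    and "0 \<le> K"
  shows "(\<Sum>w1\<in>W1. \<Sum>w2\<in>W2. Q1 (d w1 w2) w1 * Q2 (e w1 w2) w2) \<le> card D * K"
proof -
  have inner: "(\<Sum>w2\<in>W2. Q1 (d w1 w2) w1 * Q2 (e w1 w2) w2) \<le> (\<Sum>d0\<in>D. Q1 d0 w1 * K)"
    if w1: "w1 \<in> W1" for w1
  proof -
    have "(\<Sum>w2\<in>W2. Q1 (d w1 w2) w1 * Q2 (e w1 w2) w2)
      = (\<Sum>d0\<in>D. \<Sum>w2\<in>{w2 \<in> W2. d w1 w2 = d0}. Q1 (d w1 w2) w1 * Q2 (e w1 w2) w2)"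
      using fin D[OF w1] by (intro sum.group[symmetric]) auto
    \<comment> \<open>Within the class of \<open>d0\<close> receiver 1 always sees
      \<open>d0\<close>, so its factor is constant; what remains is a decoder for \<open>w2\<close>
      whose view takes at most \<open>K\<close> values.\<close>
    also have "\<dots> = (\<Sum>d0\<in>D. Q1 d0 w1 * (\<Sum>w2\<in>{w2 \<in> W2. d w1 w2 = d0}. Q2 (e w1 w2) w2))"
      unfolding sum_distrib_left by (intro sum.cong) auto
    also have "\<dots> \<le> (\<Sum>d0\<in>D. Q1 d0 w1 * K)"
    proof (intro sum_mono mult_left_mono Q1)
      fix d0
      have "(\<Sum>w2\<in>{w2 \<in> W2. d w1 w2 = d0}. Q2 d' w2) \<le> 1" for d'
        using sum_mono2[of W2 "{w2 \<in> W2. d w1 w2 = d0}" "Q2 d'"] Q2 fin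
        by (metis (no_types, lifting) mem_Collect_eq order_trans subsetI)
      then have "(\<Sum>w2\<in>{w2 \<in> W2. d w1 w2 = d0}. Q2 (e w1 w2) w2)
        \<le> card (e w1 ` {w2 \<in> W2. d w1 w2 = d0})"
        using fin Q2 by (intro sum_decoding_le_card) auto
      then show "(\<Sum>w2\<in>{w2 \<in> W2. d w1 w2 = d0}. Q2 (e w1 w2) w2) \<le> K"
        using K[OF w1, of d0] by linarith
    qed
    finally show ?thesis .
  qed
  have "(\<Sum>w1\<in>W1. \<Sum>w2\<in>W2. Q1 (d w1 w2) w1 * Q2 (e w1 w2) w2) \<le> (\<Sum>w1\<in>W1. \<Sum>d0\<in>D. Q1 d0 w1 * K)"
    by (intro sum_mono inner)
  \<comment> \<open>Only now is the decoder of receiver 1 spent: for each \<open>d0\<close> its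
    probabilities add up to at most 1.\<close>
  also have "\<dots> = (\<Sum>d0\<in>D. (\<Sum>w1\<in>W1. Q1 d0 w1) * K)"
    unfolding sum_distrib_right by (rule sum.swap)
  also have "\<dots> \<le> (\<Sum>d0\<in>D. 1 * K)"
    by (intro sum_mono mult_right_mono Q1 \<open>0 \<le> K\<close>)
  finally show ?thesis by simp
qed

text \<open>The counting analogue of H(D1 | V1) - H(V2): since the receiver's view is an injective
  function of the interference, every class of v1 accounts for at most K correct decodings,
  interference classes being counted once.\<close>
lemma sum_decoding_weighted_le:
  fixes Q :: "'d \<Rightarrow> 'u \<Rightarrow> real" and v1 :: "'u \<Rightarrow> 'v" and v2 :: "'w \<Rightarrow> 'x" and K :: real
  assumes fin: "finite W1" "finite W2"
    and inj: "\<And>w. w \<in> W1 \<Longrightarrow> inj_on (d w) (v2 ` W2)"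
    and D: "\<And>w x. w \<in> W1 \<Longrightarrow> x \<in> v2 ` W2 \<Longrightarrow> d w x \<in> D (v1 w)"
    and K: "\<And>y. finite (D y)" "\<And>y. real (card (D y)) \<le> K"
    and Q: "\<And>d w. 0 \<le> Q d w" "\<And>d. (\<Sum>w\<in>W1. Q d w) \<le> 1"
  shows "(\<Sum>w1\<in>W1. \<Sum>w2\<in>W2. Q (d w1 (v2 w2)) w1
      * (card {w \<in> W1. v1 w = v1 w1} / card {w \<in> W2. v2 w = v2 w2})) \<le> card W1 * K"
proof -
  let ?N1 = "\<lambda>y. real (card {w \<in> W1. v1 w = y})" and ?N2 = "\<lambda>x. real (card {w \<in> W2. v2 w = x})"
  have inner: "(\<Sum>w2\<in>W2. Q (d w1 (v2 w2)) w1 * (?N1 (v1 w1) / ?N2 (v2 w2)))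
    \<le> ?N1 (v1 w1) * (\<Sum>d0\<in>D (v1 w1). Q d0 w1)" if w1: "w1 \<in> W1" for w1
  proof -
    have "(\<Sum>w2\<in>W2. Q (d w1 (v2 w2)) w1 * (?N1 (v1 w1) / ?N2 (v2 w2)))
      = (\<Sum>x\<in>v2 ` W2. \<Sum>w2\<in>{w2 \<in> W2. v2 w2 = x}. Q (d w1 (v2 w2)) w1 * (?N1 (v1 w1) / ?N2 (v2 w2)))"
      using fin by (intro sum.group[symmetric]) auto
    \<comment> \<open>Dividing by the class size counts every value of the interference exactly
      once.\<close>
    also have "\<dots> = (\<Sum>x\<in>v2 ` W2. ?N1 (v1 w1) * Q (d w1 x) w1)"
    proof (intro sum.cong refl)
      fix x assume "x \<in> v2 ` W2"
      then have "?N2 x \<noteq> 0" using fin by auto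
      moreover have "(\<Sum>w2\<in>{w2 \<in> W2. v2 w2 = x}. Q (d w1 (v2 w2)) w1 * (?N1 (v1 w1) / ?N2 (v2 w2)))
        = (\<Sum>w2\<in>{w2 \<in> W2. v2 w2 = x}. Q (d w1 x) w1 * (?N1 (v1 w1) / ?N2 x))"
        by (intro sum.cong) auto
      ultimately show "(\<Sum>w2\<in>{w2 \<in> W2. v2 w2 = x}. Q (d w1 (v2 w2)) w1 * (?N1 (v1 w1) / ?N2 (v2 w2)))
        = ?N1 (v1 w1) * Q (d w1 x) w1" by simp
    qed
    \<comment> \<open>By injectivity distinct interference values give distinct views, all of them
      in \<open>D (v1 w1)\<close>.\<close>
    also have "\<dots> = ?N1 (v1 w1) * (\<Sum>d0\<in>d w1 ` v2 ` W2. Q d0 w1)"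
      by (simp add: sum_distrib_left sum.reindex[OF inj[OF w1]])
    also have "\<dots> \<le> ?N1 (v1 w1) * (\<Sum>d0\<in>D (v1 w1). Q d0 w1)"
      using K D[OF w1] Q by (intro mult_left_mono sum_mono2) auto
    finally show ?thesis .
  qed
  have "(\<Sum>w1\<in>W1. \<Sum>w2\<in>W2. Q (d w1 (v2 w2)) w1 * (?N1 (v1 w1) / ?N2 (v2 w2)))
    \<le> (\<Sum>w1\<in>W1. ?N1 (v1 w1) * (\<Sum>d0\<in>D (v1 w1). Q d0 w1))"
    by (intro sum_mono inner)
  \<comment> \<open>The weight \<open>?N1\<close> is constant on a class of \<open>v1\<close>, and
    the whole class shares one set of at most \<open>K\<close> views; summing \<open>?N1 y\<close>
    over the classes gives back \<open>card W1\<close>.\<close>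
  also have "\<dots> = (\<Sum>y\<in>v1 ` W1. \<Sum>w1\<in>{w \<in> W1. v1 w = y}. ?N1 (v1 w1) * (\<Sum>d0\<in>D (v1 w1). Q d0 w1))"
    using fin by (intro sum.group[symmetric]) auto
  also have "\<dots> = (\<Sum>y\<in>v1 ` W1. ?N1 y * (\<Sum>w1\<in>{w \<in> W1. v1 w = y}. \<Sum>d0\<in>D y. Q d0 w1))"
    unfolding sum_distrib_left[of _ _ "{w \<in> W1. v1 w = _}"] by (intro sum.cong) auto
  also have "\<dots> \<le> (\<Sum>y\<in>v1 ` W1. ?N1 y * K)"
  proof (intro sum_mono mult_left_mono)
    fix y
    have "(\<Sum>w1\<in>{w \<in> W1. v1 w = y}. \<Sum>d0\<in>D y. Q d0 w1) = (\<Sum>d0\<in>D y. \<Sum>w1\<in>{w \<in> W1. v1 w = y}. Q d0 w1)"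
      by (rule sum.swap)
    also have "\<dots> \<le> (\<Sum>d0\<in>D y. \<Sum>w1\<in>W1. Q d0 w1)"
      using fin Q by (intro sum_mono sum_mono2) auto
    also have "\<dots> \<le> (\<Sum>d0\<in>D y. 1)"
      by (intro sum_mono Q)
    also have "\<dots> \<le> K" using K by simp
    finally show "(\<Sum>w1\<in>{w \<in> W1. v1 w = y}. \<Sum>d0\<in>D y. Q d0 w1) \<le> K" .
  qed simp
  also have "\<dots> = (\<Sum>y\<in>v1 ` W1. \<Sum>w1\<in>{w \<in> W1. v1 w = y}. K)" by simp
  also have "\<dots> = card W1 * K"
    using fin by (subst sum.group) auto
  finally show ?thesis .
qed

text \<open>Cauchy--Schwarz with weights N1 / N2, the ratio of the class sizes: it lets the two entropies
  H(V1) and H(V2) of the genie signals cancel between the receivers.\<close>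
lemma sum_decoding_genie_le:
  fixes s1 s2 :: "'u \<Rightarrow> 'w \<Rightarrow> real" and K :: real
  assumes fin: "finite W1" "finite W2"
    and inj: "\<And>w. w \<in> W1 \<Longrightarrow> inj_on (d1 w) (v2 ` W2)" "\<And>w. w \<in> W2 \<Longrightarrow> inj_on (d2 w) (v1 ` W1)"
    and D1: "\<And>w x. w \<in> W1 \<Longrightarrow> x \<in> v2 ` W2 \<Longrightarrow> d1 w x \<in> D1 (v1 w)"
      "\<And>y. finite (D1 y)" "\<And>y. real (card (D1 y)) \<le> K"
    and D2: "\<And>w x. w \<in> W2 \<Longrightarrow> x \<in> v1 ` W1 \<Longrightarrow> d2 w x \<in> D2 (v2 w)"
      "\<And>y. finite (D2 y)" "\<And>y. real (card (D2 y)) \<le> K"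
    and Q1: "\<And>d w. 0 \<le> Q1 d w" "\<And>d. (\<Sum>w\<in>W1. Q1 d w) \<le> 1"
    and Q2: "\<And>d w. 0 \<le> Q2 d w" "\<And>d. (\<Sum>w\<in>W2. Q2 d w) \<le> 1"
    and s1: "\<And>w1 w2. w1 \<in> W1 \<Longrightarrow> w2 \<in> W2 \<Longrightarrow> 0 \<le> s1 w1 w2 \<and> s1 w1 w2 \<le> 1 \<and> s1 w1 w2 \<le> c * Q1 (d1 w1 (v2 w2)) w1"
    and s2: "\<And>w1 w2. w1 \<in> W1 \<Longrightarrow> w2 \<in> W2 \<Longrightarrow> 0 \<le> s2 w1 w2 \<and> s2 w1 w2 \<le> 1 \<and> s2 w1 w2 \<le> c * Q2 (d2 w2 (v1 w1)) w2"
    and "0 \<le> c"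
  shows "(\<Sum>w1\<in>W1. \<Sum>w2\<in>W2. s1 w1 w2 * s2 w1 w2)\<^sup>2 \<le> (c * K)\<^sup>2 * (real (card W1) * real (card W2))"
proof -
  let ?N1 = "\<lambda>w1. real (card {w \<in> W1. v1 w = v1 w1})" and ?N2 = "\<lambda>w2. real (card {w \<in> W2. v2 w = v2 w2})"
  let ?a = "\<lambda>(w1, w2). sqrt (s1 w1 w2 * (?N1 w1 / ?N2 w2))"
  let ?b = "\<lambda>(w1, w2). sqrt (s2 w1 w2 * (?N2 w2 / ?N1 w1))"
  have pos: "0 < ?N1 w1" "0 < ?N2 w2" if "w1 \<in> W1" "w2 \<in> W2" for w1 w2
    using that fin by (auto simp: card_gt_0_iff)
  have "(\<Sum>w1\<in>W1. \<Sum>w2\<in>W2. s1 w1 w2 * s2 w1 w2) = (\<Sum>(w1, w2)\<in>W1 \<times> W2. s1 w1 w2 * s2 w1 w2)"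
    by (rule sum.cartesian_product)
  \<comment> \<open>The weights cancel in \<open>?a p * ?b p\<close>, which leaves sqrt (s1 s2);
    this dominates s1 s2 because both factors are at most 1.\<close>
  also have "\<dots> \<le> (\<Sum>p\<in>W1 \<times> W2. ?a p * ?b p)"
  proof (intro sum_mono, clarify)
    fix w1 w2 assume w: "w1 \<in> W1" "w2 \<in> W2"
    have s: "0 \<le> s1 w1 w2 * s2 w1 w2" "s1 w1 w2 * s2 w1 w2 \<le> 1"
      using s1[OF w] s2[OF w] by (auto intro: mult_le_one)
    have "sqrt (s1 w1 w2 * (?N1 w1 / ?N2 w2)) * sqrt (s2 w1 w2 * (?N2 w2 / ?N1 w1)) = sqrt (s1 w1 w2 * s2 w1 w2)"
      using pos[OF w] by (simp add: real_sqrt_mult[symmetric])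
    moreover have "s1 w1 w2 * s2 w1 w2 \<le> sqrt (s1 w1 w2 * s2 w1 w2)"
      using s by (intro real_le_rsqrt) (auto simp: power2_eq_square intro: mult_left_le)
    ultimately show "s1 w1 w2 * s2 w1 w2 \<le> sqrt (s1 w1 w2 * (?N1 w1 / ?N2 w2)) * sqrt (s2 w1 w2 * (?N2 w2 / ?N1 w1))"
      by simp
  qed
  finally have "(\<Sum>w1\<in>W1. \<Sum>w2\<in>W2. s1 w1 w2 * s2 w1 w2)\<^sup>2 \<le> (\<Sum>p\<in>W1 \<times> W2. ?a p * ?b p)\<^sup>2"
    using s1 s2 by (intro power_mono sum_nonneg mult_nonneg_nonneg) auto
  also have "\<dots> \<le> (\<Sum>p\<in>W1 \<times> W2. (?a p)\<^sup>2) * (\<Sum>p\<in>W1 \<times> W2. (?b p)\<^sup>2)"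
    by (rule Cauchy_Schwarz_ineq_sum)
  \<comment> \<open>The first factor is the weighted bound for receiver 1; the second is the same
    bound with the users exchanged, its weights being the reciprocals.\<close>
  also have "\<dots> \<le> (c * (card W1 * K)) * (c * (card W2 * K))"
  proof (intro mult_mono sum_nonneg)
    have "(\<Sum>p\<in>W1 \<times> W2. (?a p)\<^sup>2) = (\<Sum>w1\<in>W1. \<Sum>w2\<in>W2. s1 w1 w2 * (?N1 w1 / ?N2 w2))"
      using s1 by (subst sum.cartesian_product) (intro sum.cong, auto)
    also have "\<dots> \<le> (\<Sum>w1\<in>W1. \<Sum>w2\<in>W2. c * (Q1 (d1 w1 (v2 w2)) w1 * (?N1 w1 / ?N2 w2)))"
      unfolding mult.assoc[symmetric] times_divide_eq_right using s1
      by (intro sum_mono divide_right_mono mult_right_mono) auto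
    also have "\<dots> = c * (\<Sum>w1\<in>W1. \<Sum>w2\<in>W2. Q1 (d1 w1 (v2 w2)) w1 * (?N1 w1 / ?N2 w2))"
      by (simp add: sum_distrib_left)
    also have "\<dots> \<le> c * (card W1 * K)"
      by (intro mult_left_mono sum_decoding_weighted_le[where D=D1] fin inj D1 Q1 \<open>0 \<le> c\<close>)
    finally show "(\<Sum>p\<in>W1 \<times> W2. (?a p)\<^sup>2) \<le> c * (card W1 * K)" .
    have "(\<Sum>p\<in>W1 \<times> W2. (?b p)\<^sup>2) = (\<Sum>w1\<in>W1. \<Sum>w2\<in>W2. s2 w1 w2 * (?N2 w2 / ?N1 w1))"
      using s2 by (subst sum.cartesian_product) (intro sum.cong, auto)
    also have "\<dots> = (\<Sum>w2\<in>W2. \<Sum>w1\<in>W1. s2 w1 w2 * (?N2 w2 / ?N1 w1))" by (rule sum.swap)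
    also have "\<dots> \<le> (\<Sum>w2\<in>W2. \<Sum>w1\<in>W1. c * (Q2 (d2 w2 (v1 w1)) w2 * (?N2 w2 / ?N1 w1)))"
      unfolding mult.assoc[symmetric] times_divide_eq_right using s2
      by (intro sum_mono divide_right_mono mult_right_mono) auto
    also have "\<dots> = c * (\<Sum>w2\<in>W2. \<Sum>w1\<in>W1. Q2 (d2 w2 (v1 w1)) w2 * (?N2 w2 / ?N1 w1))"
      by (simp add: sum_distrib_left)
    also have "\<dots> \<le> c * (card W2 * K)"
      by (intro mult_left_mono sum_decoding_weighted_le[where D=D2] fin inj D2 Q2 \<open>0 \<le> c\<close>)
    finally show "(\<Sum>p\<in>W1 \<times> W2. (?b p)\<^sup>2) \<le> c * (card W2 * K)" .
    have "0 \<le> K" using D1(3)[of undefined] by linarith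
    then show "0 \<le> c * (card W1 * K)" using \<open>0 \<le> c\<close> by simp
  qed auto
  also have "\<dots> = (c * K)\<^sup>2 * (real (card W1) * real (card W2))" by (simp add: power2_eq_square)
  finally show ?thesis .
qed

section \<open>Converse bounds for a code of fixed length\<close>

lemma card_PiE_int_le:
  fixes l h :: "nat \<Rightarrow> int"
  assumes "\<And>t. t < n \<Longrightarrow> real_of_int (h t - l t) + 1 \<le> r" "0 \<le> r"
  shows "real (card (PiE {..<n} (\<lambda>t. {l t..h t}))) \<le> r ^ n"
proof -
  have "real (card (PiE {..<n} (\<lambda>t. {l t..h t}))) = (\<Prod>t<n. real (nat (h t - l t + 1)))"
    by (simp add: card_PiE)
  also have "\<dots> \<le> (\<Prod>t<n. r)"
  proof (intro prod_mono conjI)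
    fix t assume "t \<in> {..<n}"
    then have "real_of_int (h t - l t + 1) \<le> r" using assms(1)[of t] by simp
    then show "real (nat (h t - l t + 1)) \<le> r" using assms(2) by linarith
  qed simp
  finally show ?thesis by simp
qed

text \<open>The restriction to indices below \<open>n\<close> makes words extensional, so that a
  word is determined by its symbols and \<open>cell n a\<close> is injective on them.\<close>

definition quantize :: "real \<Rightarrow> nat \<Rightarrow> (nat \<Rightarrow> real) \<Rightarrow> nat \<Rightarrow> int" where
  "quantize \<sigma> n x = (\<lambda>t\<in>{..<n}. \<lfloor>x t / \<sigma>\<rfloor>)"

text \<open>Two floors together lose between 0 and 2; the added 1 centres this error, so that the
  true signal lies within one \<sigma> of the grid point.\<close>

definition cell :: "nat \<Rightarrow> (nat \<Rightarrow> int) \<Rightarrow> (nat \<Rightarrow> int) \<Rightarrow> nat \<Rightarrow> int" where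
  "cell n a v = (\<lambda>t\<in>{..<n}. a t + v t + 1)"

lemma cell_centre:
  assumes "0 < \<sigma>" "t < n"
  shows "\<bar>x t + y t - \<sigma> * cell n (quantize \<sigma> n x) (quantize \<sigma> n y) t\<bar> \<le> \<sigma>"
proof -
  let ?k = "\<lfloor>x t / \<sigma>\<rfloor>" and ?l = "\<lfloor>y t / \<sigma>\<rfloor>"
  have "\<sigma> * ?k \<le> x t" "x t \<le> \<sigma> * (?k + 1)" "\<sigma> * ?l \<le> y t" "y t \<le> \<sigma> * (?l + 1)"
    using floor_divide_lower[OF assms(1), of "x t"] floor_divide_upper[OF assms(1), of "x t"]
      floor_divide_lower[OF assms(1), of "y t"] floor_divide_upper[OF assms(1), of "y t"]
    by (simp_all add: mult.commute)
  moreover have "\<sigma> * cell n (quantize \<sigma> n x) (quantize \<sigma> n y) t = \<sigma> * ?k + \<sigma> * ?l + \<sigma>"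
    using assms(2) by (simp add: cell_def quantize_def algebra_simps)
  ultimately show ?thesis by (simp add: algebra_simps)
qed

lemma cell_inj: "inj_on (cell n a) (extensional {..<n})"
proof (rule inj_onI)
  fix v w assume ext: "v \<in> extensional {..<n}" "w \<in> extensional {..<n}" and eq: "cell n a v = cell n a w"
  show "v = w"
  proof (rule extensionalityI[OF ext])
    fix t assume "t \<in> {..<n}"
    then show "v t = w t" using fun_cong[OF eq, of t] by (simp add: cell_def)
  qed
qed

lemma quantize_extensional: "quantize \<sigma> n x \<in> extensional {..<n}"
  by (simp add: quantize_def)

lemma square_power: "(x ^ n)\<^sup>2 = (x\<^sup>2) ^ n" for x :: real
  by (simp add: power_mult[symmetric] mult.commute)

locale interference_code =
  fixes \<sigma> g A :: real and n M1 M2 :: nat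
    and f1 f2 :: "nat \<Rightarrow> nat \<Rightarrow> real" and \<phi>1 \<phi>2 :: "(nat \<Rightarrow> real) \<Rightarrow> nat"
  assumes \<sigma>: "0 < \<sigma>" and g: "0 < g" and A: "0 \<le> A"
    and messages: "0 < M1" "0 < M2"
    and peak1: "\<And>m t. m \<in> {1..M1} \<Longrightarrow> t < n \<Longrightarrow> 0 \<le> f1 m t \<and> f1 m t \<le> A"
    and peak2: "\<And>m t. m \<in> {1..M2} \<Longrightarrow> t < n \<Longrightarrow> 0 \<le> f2 m t \<and> f2 m t \<le> A"
    and decoders: "valid_decoder n \<phi>1" "valid_decoder n \<phi>2"
begin

definition "e1 = err_prob \<sigma> n 1 g M1 M2 f1 f2 \<phi>1"
definition "e2 = err_prob \<sigma> n 1 g M2 M1 f2 f1 \<phi>2"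
text \<open>The factor 1 keeps the shape of the received signal in \<open>err_prob\<close> with
  direct gain 1.\<close>

definition "S1 w1 w2 = success \<sigma> n (\<lambda>t. 1 * f1 w1 t + g * f2 w2 t) \<phi>1 w1"
definition "S2 w1 w2 = success \<sigma> n (\<lambda>t. 1 * f2 w2 t + g * f1 w1 t) \<phi>2 w2"

abbreviation "a1 w \<equiv> quantize \<sigma> n (f1 w)"
abbreviation "a2 w \<equiv> quantize \<sigma> n (f2 w)"
abbreviation "v1 w \<equiv> quantize \<sigma> n (\<lambda>t. g * f1 w t)"
abbreviation "v2 w \<equiv> quantize \<sigma> n (\<lambda>t. g * f2 w t)"
abbreviation "C \<equiv> sqrt (2 * exp 1) :: real"

lemma swap: "interference_code \<sigma> g A n M2 M1 f2 f1 \<phi>2 \<phi>1"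
  using \<sigma> g A messages peak1 peak2 decoders by unfold_locales

lemma sum_S1: "(\<Sum>w1\<in>{1..M1}. \<Sum>w2\<in>{1..M2}. S1 w1 w2) = (1 - e1) * (real M1 * real M2)"
  unfolding S1_def e1_def using \<sigma> decoders messages by (intro err_prob_eq) auto

lemma sum_S2: "(\<Sum>w1\<in>{1..M1}. \<Sum>w2\<in>{1..M2}. S2 w1 w2) = (1 - e2) * (real M1 * real M2)"
  unfolding S2_def e2_def
  by (subst sum.swap, subst err_prob_eq) (use \<sigma> decoders messages in auto)

lemma S1_le: "S1 w1 w2 \<le> C ^ n * smeared \<sigma> n \<phi>1 (cell n (a1 w1) (v2 w2)) w1"
  unfolding S1_def using cell_centre[OF \<sigma>, of _ n "f1 w1" "\<lambda>t. g * f2 w2 t"]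
  by (intro success_le_smeared \<sigma> decoders) simp

lemma S2_le: "S2 w1 w2 \<le> C ^ n * smeared \<sigma> n \<phi>2 (cell n (a2 w2) (v1 w1)) w2"
  unfolding S2_def using cell_centre[OF \<sigma>, of _ n "f2 w2" "\<lambda>t. g * f1 w1 t"]
  by (intro success_le_smeared \<sigma> decoders) simp

lemma S_bounds: "0 \<le> S1 w1 w2 \<and> S1 w1 w2 \<le> 1" "0 \<le> S2 w1 w2 \<and> S2 w1 w2 \<le> 1"
  unfolding S1_def S2_def using success_bounds[OF \<sigma>] by auto

lemma sum_smeared_messages: "(\<Sum>w\<in>{1..M1}. smeared \<sigma> n \<phi>1 d w) \<le> 1" "(\<Sum>w\<in>{1..M2}. smeared \<sigma> n \<phi>2 d w) \<le> 1"
  using sum_smeared_le_1 \<sigma> decoders by auto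

text \<open>The product stands in for the probability that both receivers succeed; the estimate is
  the union bound in the form (1 - S1) (1 - S2) \<ge> 0.\<close>

lemma sum_both_ge: "(1 - e1 - e2) * (real M1 * real M2) \<le> (\<Sum>w1\<in>{1..M1}. \<Sum>w2\<in>{1..M2}. S1 w1 w2 * S2 w1 w2)"
proof -
  have "(1 - e1 - e2) * (real M1 * real M2) = (\<Sum>w1\<in>{1..M1}. \<Sum>w2\<in>{1..M2}. S1 w1 w2 + S2 w1 w2 - 1)"
    unfolding sum_subtractf sum.distrib sum_S1 sum_S2 by (simp add: algebra_simps)
  also have "\<dots> \<le> (\<Sum>w1\<in>{1..M1}. \<Sum>w2\<in>{1..M2}. S1 w1 w2 * S2 w1 w2)"
  proof (intro sum_mono)
    fix w1 w2
    have "0 \<le> (1 - S1 w1 w2) * (1 - S2 w1 w2)"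
      using S_bounds by (intro mult_nonneg_nonneg) (auto simp: diff_ge_0_iff_ge)
    then show "S1 w1 w2 + S2 w1 w2 - 1 \<le> S1 w1 w2 * S2 w1 w2" by (simp add: algebra_simps)
  qed
  finally show ?thesis .
qed

section \<open>Counting the possible views\<close>

lemma a1_range:
  assumes "w \<in> {1..M1}" "t < n"
  shows "0 \<le> a1 w t" "a1 w t \<le> \<lfloor>A / \<sigma>\<rfloor>"
  using assms peak1[OF assms] \<sigma> by (auto simp: quantize_def intro!: floor_mono divide_right_mono)

lemma v1_range:
  assumes "w \<in> {1..M1}" "t < n"
  shows "0 \<le> v1 w t" "v1 w t \<le> \<lfloor>g * A / \<sigma>\<rfloor>"
  using assms peak1[OF assms] \<sigma> g
  by (auto simp: quantize_def intro!: floor_mono divide_right_mono mult_left_mono)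

text \<open>Knowing the own signal as the other receiver sees it, scaled by \<open>g\<close> and at
  resolution \<sigma>, fixes the own symbol up to about 1 / g cells: the residual uncertainty given
  the genie signal.\<close>

lemma a1_given_v1:
  assumes "t < n"
  shows "\<lfloor>v1 w t / g\<rfloor> \<le> a1 w t" "a1 w t \<le> \<lfloor>(real_of_int (v1 w t) + 1) / g\<rfloor>"
proof -
  have "v1 w t \<le> g * (f1 w t / \<sigma>)" "g * (f1 w t / \<sigma>) \<le> v1 w t + 1"
    using assms floor_correct[of "g * f1 w t / \<sigma>"] by (auto simp: quantize_def)
  then have "v1 w t / g \<le> f1 w t / \<sigma>" "f1 w t / \<sigma> \<le> (real_of_int (v1 w t) + 1) / g"
    using g by (auto simp: field_simps)
  then show "\<lfloor>v1 w t / g\<rfloor> \<le> a1 w t" "a1 w t \<le> \<lfloor>(real_of_int (v1 w t) + 1) / g\<rfloor>"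
    using assms by (auto simp: quantize_def intro!: floor_mono)
qed

lemmas v2_range = interference_code.v1_range[OF swap]
lemmas a2_given_v2 = interference_code.a1_given_v1[OF swap]

lemma floor_div_width: "real_of_int (\<lfloor>(v + 1) / g\<rfloor> - \<lfloor>v / g\<rfloor>) \<le> 1 / g + 1"
proof -
  have "(v + 1) / g = v / g + 1 / g" by (simp add: add_divide_distrib)
  then show ?thesis using floor_correct[of "v / g"] floor_correct[of "(v + 1) / g"] by simp linarith
qed

lemma quotients_nonneg: "0 \<le> A / \<sigma>" "0 \<le> g * A / \<sigma>" "0 \<le> 1 / g"
  using \<sigma> g A by auto

text \<open>For each fixed \<open>w2\<close> the interference merely translates the set of views, so
  its strength does not enter: at most A / \<sigma> + 1 values per symbol.\<close>

lemma single_rate_bound: "(1 - e1) * real M1 \<le> (C * (A / \<sigma> + 1)) ^ n"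
proof -
  have "(\<Sum>w1\<in>{1..M1}. S1 w1 w2) \<le> (C * (A / \<sigma> + 1)) ^ n" if w2: "w2 \<in> {1..M2}" for w2
  proof -
    let ?D = "PiE {..<n} (\<lambda>t. {v2 w2 t + 1 .. v2 w2 t + \<lfloor>A / \<sigma>\<rfloor> + 1})"
    have "(\<Sum>w1\<in>{1..M1}. S1 w1 w2) \<le> (\<Sum>w1\<in>{1..M1}. C ^ n * smeared \<sigma> n \<phi>1 (cell n (a1 w1) (v2 w2)) w1)"
      by (intro sum_mono S1_le)
    also have "\<dots> = C ^ n * (\<Sum>w1\<in>{1..M1}. smeared \<sigma> n \<phi>1 (cell n (a1 w1) (v2 w2)) w1)"
      by (simp add: sum_distrib_left)
    also have "(\<Sum>w1\<in>{1..M1}. smeared \<sigma> n \<phi>1 (cell n (a1 w1) (v2 w2)) w1) \<le> card ?D"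
    proof (intro sum_decoding_le_card smeared_nonneg sum_smeared_messages finite_PiE)
      fix w1 assume w1: "w1 \<in> {1..M1}"
      show "cell n (a1 w1) (v2 w2) \<in> ?D"
        unfolding cell_def restrict_PiE_iff using a1_range[OF w1] by simp
    qed auto
    also have "real (card ?D) \<le> (A / \<sigma> + 1) ^ n"
      using quotients_nonneg by (intro card_PiE_int_le) auto
    finally show ?thesis by (simp add: power_mult_distrib)
  qed
  then have "(\<Sum>w2\<in>{1..M2}. \<Sum>w1\<in>{1..M1}. S1 w1 w2) \<le> (\<Sum>w2\<in>{1..M2}. (C * (A / \<sigma> + 1)) ^ n)"
    by (rule sum_mono)
  then have "(1 - e1) * (real M1 * real M2) \<le> real M2 * (C * (A / \<sigma> + 1)) ^ n"
    unfolding sum.swap[of _ "{1..M1}"] sum_S1[symmetric] by simp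
  then have "real M2 * ((1 - e1) * real M1) \<le> real M2 * (C * (A / \<sigma> + 1)) ^ n"
    by (simp only: mult_ac)
  then show ?thesis using messages by (subst (asm) mult_le_cancel_left_pos) auto
qed

lemma sum_rate_bound_one_sided:
  "(1 - e1 - e2) * (real M1 * real M2) \<le> (C\<^sup>2 * ((A / \<sigma> + g * A / \<sigma> + 1) * (1 / g + 2))) ^ n"
proof -
  let ?D = "PiE {..<n} (\<lambda>_. {1 .. \<lfloor>A / \<sigma>\<rfloor> + \<lfloor>g * A / \<sigma>\<rfloor> + 1})"
  let ?Q1 = "\<lambda>w1 w2. smeared \<sigma> n \<phi>1 (cell n (a1 w1) (v2 w2)) w1"
  let ?Q2 = "\<lambda>w1 w2. smeared \<sigma> n \<phi>2 (cell n (a2 w2) (v1 w1)) w2"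
  have "(1 - e1 - e2) * (real M1 * real M2) \<le> (\<Sum>w1\<in>{1..M1}. \<Sum>w2\<in>{1..M2}. S1 w1 w2 * S2 w1 w2)"
    by (rule sum_both_ge)
  also have "\<dots> \<le> (\<Sum>w1\<in>{1..M1}. \<Sum>w2\<in>{1..M2}. (C ^ n * ?Q1 w1 w2) * (C ^ n * ?Q2 w1 w2))"
    using S_bounds by (intro sum_mono mult_mono S1_le S2_le) (auto intro!: mult_nonneg_nonneg smeared_nonneg)
  also have "\<dots> = (C ^ n)\<^sup>2 * (\<Sum>w1\<in>{1..M1}. \<Sum>w2\<in>{1..M2}. ?Q1 w1 w2 * ?Q2 w1 w2)"
    unfolding sum_distrib_left by (intro sum.cong refl) (simp add: power2_eq_square)
  also have "\<dots> \<le> (C ^ n)\<^sup>2 * (card ?D * (1 / g + 2) ^ n)"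
  proof (intro mult_left_mono smeared_nonneg sum_smeared_messages finite_PiE
      sum_decoding_one_sided_le[where d="\<lambda>w1 w2. cell n (a1 w1) (v2 w2)"
        and e="\<lambda>w1 w2. cell n (a2 w2) (v1 w1)"])
    fix w1 w2 assume "w1 \<in> {1..M1}" "w2 \<in> {1..M2}"
    then show "cell n (a1 w1) (v2 w2) \<in> ?D"
      unfolding cell_def restrict_PiE_iff
      using a1_range v2_range by (simp add: add_mono)
  next
    \<comment> \<open>Given \<open>w1\<close>, the view \<open>d0\<close> reveals
      \<open>v2 w2\<close> exactly by subtraction; each symbol of \<open>a2 w2\<close> is then known
      up to 1 / g + 2 values, and \<open>v1 w1\<close> is a known translation.\<close>
    fix w1 d0
    let ?l = "\<lambda>t. \<lfloor>real_of_int (d0 t - a1 w1 t - 1) / g\<rfloor>" and ?h = "\<lambda>t. \<lfloor>(real_of_int (d0 t - a1 w1 t - 1) + 1) / g\<rfloor>"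
    let ?E = "PiE {..<n} (\<lambda>t. {?l t + v1 w1 t + 1 .. ?h t + v1 w1 t + 1})"
    have "(\<lambda>w2. cell n (a2 w2) (v1 w1)) ` {w2 \<in> {1..M2}. cell n (a1 w1) (v2 w2) = d0} \<subseteq> ?E"
    proof clarify
      fix w2
      let ?d = "cell n (a1 w1) (v2 w2)"
      have "v2 w2 t = ?d t - a1 w1 t - 1" if "t < n" for t
        using that by (simp add: cell_def)
      then show "cell n (a2 w2) (v1 w1) \<in> PiE {..<n} (\<lambda>t.
          {\<lfloor>real_of_int (?d t - a1 w1 t - 1) / g\<rfloor> + v1 w1 t + 1 ..
           \<lfloor>(real_of_int (?d t - a1 w1 t - 1) + 1) / g\<rfloor> + v1 w1 t + 1})"
        using a2_given_v2[of _ w2] by (auto simp: cell_def)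
    qed
    then have "card ((\<lambda>w2. cell n (a2 w2) (v1 w1)) ` {w2 \<in> {1..M2}. cell n (a1 w1) (v2 w2) = d0}) \<le> card ?E"
      by (intro card_mono finite_PiE) auto
    moreover have "real (card ?E) \<le> (1 / g + 2) ^ n"
    proof (rule card_PiE_int_le)
      fix t
      show "real_of_int (?h t + v1 w1 t + 1 - (?l t + v1 w1 t + 1)) + 1 \<le> 1 / g + 2"
        using floor_div_width[of "real_of_int (d0 t - a1 w1 t - 1)"] by (simp del: of_int_diff)
    qed (use quotients_nonneg in simp)
    ultimately show "real (card ((\<lambda>w2. cell n (a2 w2) (v1 w1)) ` {w2 \<in> {1..M2}. cell n (a1 w1) (v2 w2) = d0}))
        \<le> (1 / g + 2) ^ n" by linarith
  qed (use quotients_nonneg in auto)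
  also have "\<dots> \<le> (C ^ n)\<^sup>2 * ((A / \<sigma> + g * A / \<sigma> + 1) ^ n * (1 / g + 2) ^ n)"
  proof (intro mult_left_mono mult_right_mono card_PiE_int_le)
    have "real_of_int \<lfloor>A / \<sigma>\<rfloor> \<le> A / \<sigma>" "real_of_int \<lfloor>g * A / \<sigma>\<rfloor> \<le> g * A / \<sigma>" by simp_all
    then show "real_of_int (\<lfloor>A / \<sigma>\<rfloor> + \<lfloor>g * A / \<sigma>\<rfloor> + 1 - 1) + 1 \<le> A / \<sigma> + g * A / \<sigma> + 1"
      unfolding of_int_diff of_int_add by linarith
  qed (use quotients_nonneg in auto)
  finally show ?thesis by (simp only: power_mult_distrib square_power)
qed

text \<open>The genie signal of a receiver is its own word as it appears at the other receiver.
  Given it, a symbol of the view ranges over about 1 / g values for the own symbol and g A /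
  \<sigma> for the interference; the widths of the two intervals add instead of multiplying, since
  only the sum is seen.\<close>

lemma sum_rate_bound_genie:
  assumes "e1 + e2 \<le> 1"
  shows "(1 - e1 - e2)\<^sup>2 * (real M1 * real M2) \<le> ((C * (1 / g + g * A / \<sigma> + 2))\<^sup>2) ^ n"
proof -
  let ?K = "1 / g + g * A / \<sigma> + 2"
  let ?D = "\<lambda>y :: nat \<Rightarrow> int. PiE {..<n} (\<lambda>t. {\<lfloor>y t / g\<rfloor> + 1 .. \<lfloor>(real_of_int (y t) + 1) / g\<rfloor> + \<lfloor>g * A / \<sigma>\<rfloor> + 1})"
  have inj: "inj_on (cell n a) (quantize \<sigma> n ` X)" for a X
    by (rule inj_on_subset[OF cell_inj]) (auto simp: quantize_extensional)
  have K: "real (card (?D y)) \<le> ?K ^ n" for y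
  proof (rule card_PiE_int_le)
    fix t
    have "real_of_int \<lfloor>g * A / \<sigma>\<rfloor> \<le> g * A / \<sigma>" by (rule of_int_floor_le)
    then show "real_of_int (\<lfloor>(real_of_int (y t) + 1) / g\<rfloor> + \<lfloor>g * A / \<sigma>\<rfloor> + 1 - (\<lfloor>y t / g\<rfloor> + 1)) + 1 \<le> ?K"
      using floor_div_width[of "y t"] unfolding of_int_diff of_int_add of_int_1 by linarith
  qed (use quotients_nonneg in simp)
  have "(\<Sum>w1\<in>{1..M1}. \<Sum>w2\<in>{1..M2}. S1 w1 w2 * S2 w1 w2)\<^sup>2
    \<le> (C ^ n * ?K ^ n)\<^sup>2 * (real (card {1..M1}) * real (card {1..M2}))"
  proof (rule sum_decoding_genie_le[where ?v1.0=v1 and ?v2.0=v2 and ?D1.0="?D" and ?D2.0="?D"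
        and ?d1.0="\<lambda>w. cell n (a1 w)" and ?d2.0="\<lambda>w. cell n (a2 w)"
        and ?Q1.0="smeared \<sigma> n \<phi>1" and ?Q2.0="smeared \<sigma> n \<phi>2"])
    show "inj_on (cell n (a1 w)) (v2 ` {1..M2})" "inj_on (cell n (a2 w)) (v1 ` {1..M1})" for w
      using inj[of _ "(\<lambda>w t. g * f2 w t) ` {1..M2}"] inj[of _ "(\<lambda>w t. g * f1 w t) ` {1..M1}"]
      by (simp_all add: image_image)
    show "cell n (a1 w) x \<in> ?D (v1 w)" if "x \<in> v2 ` {1..M2}" for w x
    proof (unfold cell_def, intro restrict_PiE_iff[THEN iffD2] ballI)
      fix t assume "t \<in> {..<n}"
      then show "a1 w t + x t + 1 \<in> {\<lfloor>v1 w t / g\<rfloor> + 1 .. \<lfloor>(real_of_int (v1 w t) + 1) / g\<rfloor> + \<lfloor>g * A / \<sigma>\<rfloor> + 1}"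
        using that a1_given_v1[of t w] v2_range[of _ t] by fastforce
    qed
    show "cell n (a2 w) x \<in> ?D (v2 w)" if "x \<in> v1 ` {1..M1}" for w x
    proof (unfold cell_def, intro restrict_PiE_iff[THEN iffD2] ballI)
      fix t assume "t \<in> {..<n}"
      then show "a2 w t + x t + 1 \<in> {\<lfloor>v2 w t / g\<rfloor> + 1 .. \<lfloor>(real_of_int (v2 w t) + 1) / g\<rfloor> + \<lfloor>g * A / \<sigma>\<rfloor> + 1}"
        using that a2_given_v2[of t w] v1_range[of _ t] by fastforce
    qed
  qed (use K S_bounds S1_le S2_le smeared_nonneg sum_smeared_messages in \<open>auto intro: finite_PiE\<close>)
  moreover have "((1 - e1 - e2) * (real M1 * real M2))\<^sup>2 \<le> (\<Sum>w1\<in>{1..M1}. \<Sum>w2\<in>{1..M2}. S1 w1 w2 * S2 w1 w2)\<^sup>2"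
    using assms by (intro power_mono sum_both_ge) auto
  \<comment> \<open>Cauchy-Schwarz bounds the square of the success sum, while its right side
    contains M1 M2 only once; one factor cancels and a bound on the product M1 M2 remains.\<close>
  ultimately have "(1 - e1 - e2)\<^sup>2 * (real M1 * real M2) * (real M1 * real M2)
    \<le> (C ^ n * ?K ^ n)\<^sup>2 * (real M1 * real M2)"
    by (simp add: power2_eq_square mult_ac)
  then have "(1 - e1 - e2)\<^sup>2 * (real M1 * real M2) \<le> (C ^ n * ?K ^ n)\<^sup>2"
    using messages by (subst (asm) mult_le_cancel_right) auto
  then show ?thesis by (simp only: power_mult_distrib square_power)
qed

end

section \<open>Converse bounds on the sum capacity\<close>

text \<open>The constant \<open>c\<close> is invisible on the exponential scale: were
  \<open>R\<close> larger, (B / 2 powr R) ^ n would tend to 0 and fall below it.\<close>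

lemma rate_le_log:
  assumes "0 < c" "0 < B" "eventually (\<lambda>n. c * 2 powr (real n * R) \<le> B ^ n) sequentially"
  shows "R \<le> log 2 B"
proof (rule ccontr)
  assume "\<not> R \<le> log 2 B"
  then have "B < 2 powr R" using assms(2) by (simp add: log_le_iff not_le less_log_iff log_less_iff)
  then have "(\<lambda>n. (B / 2 powr R) ^ n) \<longlonglongrightarrow> 0"
    using assms(2) by (intro LIMSEQ_realpow_zero) auto
  then have "eventually (\<lambda>n. (B / 2 powr R) ^ n < c) sequentially"
    using assms(1) by (rule order_tendstoD)
  with assms(3) have "eventually (\<lambda>n. False) sequentially"
  proof eventually_elim
    case (elim n)
    have "2 powr (real n * R) = (2 powr R) ^ n"
      by (simp add: powr_powr[symmetric] powr_realpow[symmetric] mult.commute)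
    then show False using elim by (simp add: power_divide field_simps)
  qed
  then show False by simp
qed

lemma msg_num_ge: "2 powr (real n * R) \<le> real (msg_num R n)"
  unfolding msg_num_def by (rule real_nat_ceiling_ge)

lemma msg_num_pos: "0 < msg_num R n"
  using msg_num_ge[of n R] powr_gt_zero[of 2 "real n * R"] by linarith

lemma achievable_bounds:
  assumes "0 < \<sigma>" "0 < g" "0 \<le> A" "achievable 1 g g 1 a1 a2 A \<sigma> R"
  shows "fst R \<le> log 2 (sqrt (2 * exp 1) * (A / \<sigma> + 1))"
    and "snd R \<le> log 2 (sqrt (2 * exp 1) * (A / \<sigma> + 1))"
    and "fst R + snd R \<le> log 2 ((sqrt (2 * exp 1))\<^sup>2 * ((A / \<sigma> + g * A / \<sigma> + 1) * (1 / g + 2)))"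
    and "fst R + snd R \<le> log 2 ((sqrt (2 * exp 1) * (1 / g + g * A / \<sigma> + 2))\<^sup>2)"
proof -
  let ?M1 = "msg_num (fst R)" and ?M2 = "msg_num (snd R)"
  obtain f1 f2 \<phi>1 \<phi>2 where
    valid: "\<And>n. valid_encoder A a1 n (?M1 n) (f1 n)" "\<And>n. valid_encoder A a2 n (?M2 n) (f2 n)"
      "\<And>n. valid_decoder n (\<phi>1 n)" "\<And>n. valid_decoder n (\<phi>2 n)"
    and err: "(\<lambda>n. err_prob \<sigma> n 1 g (?M1 n) (?M2 n) (f1 n) (f2 n) (\<phi>1 n)) \<longlonglongrightarrow> 0"
      "(\<lambda>n. err_prob \<sigma> n 1 g (?M2 n) (?M1 n) (f2 n) (f1 n) (\<phi>2 n)) \<longlonglongrightarrow> 0"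
    using assms(4) unfolding achievable_def by blast
  have code: "interference_code \<sigma> g A n (?M1 n) (?M2 n) (f1 n) (f2 n) (\<phi>1 n) (\<phi>2 n)" for n
    using assms(1-3) msg_num_pos valid unfolding valid_encoder_def by unfold_locales blast+
  define e1 where "e1 n = interference_code.e1 \<sigma> g n (?M1 n) (?M2 n) (f1 n) (f2 n) (\<phi>1 n)" for n
  define e2 where "e2 n = interference_code.e2 \<sigma> g n (?M1 n) (?M2 n) (f1 n) (f2 n) (\<phi>2 n)" for n
  \<comment> \<open>Errors below 1/4 leave at least 1/2 both in 1 minus one error and in 1 minus
    their sum.\<close>
  have e1: "eventually (\<lambda>n. e1 n < 1/4) sequentially" and e2: "eventually (\<lambda>n. e2 n < 1/4) sequentially"
    using order_tendstoD(2)[OF err(1), of "1/4"] order_tendstoD(2)[OF err(2), of "1/4"]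
    unfolding e1_def e2_def interference_code.e1_def[OF code] interference_code.e2_def[OF code] by auto
  have nonneg: "0 \<le> A / \<sigma>" "0 \<le> g * A / \<sigma>" "0 < 1 / g" using assms(1-3) by auto
  have K_pos: "0 < 1 / g + g * A / \<sigma> + 2" using nonneg by linarith
  have M12: "2 powr (real n * (fst R + snd R)) \<le> real (?M1 n) * real (?M2 n)" for n
    unfolding distrib_left powr_add by (intro mult_mono msg_num_ge) auto
  show "fst R \<le> log 2 (sqrt (2 * exp 1) * (A / \<sigma> + 1))"
  proof (rule rate_le_log[of "1/2"])
    show "eventually (\<lambda>n. 1/2 * 2 powr (real n * fst R) \<le> (sqrt (2 * exp 1) * (A / \<sigma> + 1)) ^ n) sequentially"
      using e1
    proof eventually_elim
      case (elim n)
      have "1/2 * 2 powr (real n * fst R) \<le> (1 - e1 n) * real (?M1 n)"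
        using elim by (intro mult_mono msg_num_ge) auto
      also have "\<dots> \<le> (sqrt (2 * exp 1) * (A / \<sigma> + 1)) ^ n"
        unfolding e1_def by (rule interference_code.single_rate_bound[OF code])
      finally show ?case .
    qed
  qed (use nonneg in auto)
  show "snd R \<le> log 2 (sqrt (2 * exp 1) * (A / \<sigma> + 1))"
  proof (rule rate_le_log[of "1/2"])
    show "eventually (\<lambda>n. 1/2 * 2 powr (real n * snd R) \<le> (sqrt (2 * exp 1) * (A / \<sigma> + 1)) ^ n) sequentially"
      using e2
    proof eventually_elim
      case (elim n)
      have "1/2 * 2 powr (real n * snd R) \<le> (1 - e2 n) * real (?M2 n)"
        using elim by (intro mult_mono msg_num_ge) auto
      also have "e2 n = interference_code.e1 \<sigma> g n (?M2 n) (?M1 n) (f2 n) (f1 n) (\<phi>2 n)"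
        unfolding e2_def interference_code.e2_def[OF code]
          interference_code.e1_def[OF interference_code.swap[OF code]] ..
      also have "(1 - \<dots>) * real (?M2 n) \<le> (sqrt (2 * exp 1) * (A / \<sigma> + 1)) ^ n"
        by (rule interference_code.single_rate_bound[OF interference_code.swap[OF code]])
      finally show ?case .
    qed
  qed (use nonneg in auto)
  show "fst R + snd R \<le> log 2 ((sqrt (2 * exp 1))\<^sup>2 * ((A / \<sigma> + g * A / \<sigma> + 1) * (1 / g + 2)))"
  proof (rule rate_le_log[of "1/2"])
    show "eventually (\<lambda>n. 1/2 * 2 powr (real n * (fst R + snd R))
      \<le> ((sqrt (2 * exp 1))\<^sup>2 * ((A / \<sigma> + g * A / \<sigma> + 1) * (1 / g + 2))) ^ n) sequentially"
      using e1 e2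
    proof eventually_elim
      case (elim n)
      have "1/2 * 2 powr (real n * (fst R + snd R)) \<le> (1 - e1 n - e2 n) * (real (?M1 n) * real (?M2 n))"
        using elim by (intro mult_mono M12) auto
      also have "\<dots> \<le> ((sqrt (2 * exp 1))\<^sup>2 * ((A / \<sigma> + g * A / \<sigma> + 1) * (1 / g + 2))) ^ n"
        unfolding e1_def e2_def by (rule interference_code.sum_rate_bound_one_sided[OF code])
      finally show ?case .
    qed
  qed (use nonneg in \<open>auto intro!: mult_pos_pos add_nonneg_pos\<close>)
  show "fst R + snd R \<le> log 2 ((sqrt (2 * exp 1) * (1 / g + g * A / \<sigma> + 2))\<^sup>2)"
  proof (rule rate_le_log[of "(1/2)\<^sup>2"])
    show "eventually (\<lambda>n. (1/2)\<^sup>2 * 2 powr (real n * (fst R + snd R))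
      \<le> ((sqrt (2 * exp 1) * (1 / g + g * A / \<sigma> + 2))\<^sup>2) ^ n) sequentially"
      using e1 e2
    proof eventually_elim
      case (elim n)
      have "(1/2)\<^sup>2 * 2 powr (real n * (fst R + snd R)) \<le> (1 - e1 n - e2 n)\<^sup>2 * (real (?M1 n) * real (?M2 n))"
        using elim by (intro mult_mono M12 power_mono) auto
      also have "\<dots> \<le> ((sqrt (2 * exp 1) * (1 / g + g * A / \<sigma> + 2))\<^sup>2) ^ n"
        unfolding e1_def e2_def using elim
        by (intro interference_code.sum_rate_bound_genie[OF code]) (simp add: e1_def e2_def)
      finally show ?case .
    qed
  qed (use K_pos in simp_all)
qed

abbreviation (input) gdof :: "real \<Rightarrow> real" where
  "gdof \<delta> \<equiv> min (min (max (1 - \<delta>) \<delta>) (max (1 - \<delta> / 2) (\<delta> / 2))) 1"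

lemma achievable_sum_le:
  fixes \<delta> \<sigma> A :: real
  defines "P \<equiv> A / \<sigma>"
  assumes "0 < \<sigma>" "1 \<le> P"
    and ach: "achievable 1 (P powr (\<delta> - 1)) (P powr (\<delta> - 1)) 1 a1 a2 A \<sigma> R"
  shows "fst R + snd R \<le> log 2 144 + 2 * gdof \<delta> * log 2 P"
proof -
  have A: "0 \<le> A" using assms by (simp add: field_simps)
  have ginv: "1 / P powr (\<delta> - 1) = P powr (1 - \<delta>)"
    by (simp add: powr_minus_divide[symmetric])
  have gP: "P powr (\<delta> - 1) * A / \<sigma> = P powr \<delta>"
  proof -
    have "P powr (\<delta> - 1) * A / \<sigma> = P powr (\<delta> - 1) * P" by (simp add: P_def)
    then show ?thesis using assms(3) by (simp add: powr_diff)
  qed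
  have mono: "P powr x \<le> P powr y" if "x \<le> y" for x y using that assms(3) by (rule powr_mono)
  have P1: "1 \<le> P powr x" if "0 \<le> x" for x using mono[OF that] assms(3) by simp
  have C: "sqrt (2 * exp 1) \<le> (3::real)"
    using e_less_272 by (intro real_le_lsqrt) auto
  note b = achievable_bounds[OF \<open>0 < \<sigma>\<close> _ A ach, unfolded gP ginv, folded P_def]
  have logP: "log 2 (c * P powr x) = log 2 c + x * log 2 P" if "0 < c" for c x
    using that assms(3) by (simp add: log_mult log_powr)
  \<comment> \<open>144 serves all three bounds, whose constants come out as 36, 81 and 144; sqrt (2
    * exp 1) is replaced by 3 throughout.\<close>
  have bound: "fst R + snd R \<le> log 2 144 + 2 * \<gamma> * log 2 P"
    if "fst R + snd R \<le> log 2 B" "0 < B" "B \<le> 144 * P powr (2 * \<gamma>)" for B \<gamma>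
  proof -
    have "log 2 B \<le> log 2 (144 * P powr (2 * \<gamma>))" using that by (intro log_mono) auto
    then show ?thesis using that(1) logP[of 144 "2 * \<gamma>"] by simp
  qed
  have "fst R + snd R \<le> log 2 144 + 2 * 1 * log 2 P"
  proof (rule bound[of "(sqrt (2 * exp 1) * (P + 1)) ^ 2"])
    have "fst R + snd R \<le> 2 * log 2 (sqrt (2 * exp 1) * (P + 1))"
      using b(1,2) assms(3) by simp
    then show "fst R + snd R \<le> log 2 ((sqrt (2 * exp 1) * (P + 1)) ^ 2)"
      using assms(3) by (subst log_nat_power) auto
    show "0 < (sqrt (2 * exp 1) * (P + 1)) ^ 2" using assms(3) by simp
    have "(sqrt (2 * exp 1) * (P + 1)) ^ 2 \<le> (3 * (2 * P)) ^ 2"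
      using C assms(3) by (intro power_mono mult_mono) auto
    also have "\<dots> \<le> 144 * P\<^sup>2" by (simp add: power2_eq_square)
    finally show "(sqrt (2 * exp 1) * (P + 1)) ^ 2 \<le> 144 * P powr (2 * 1)"
      using assms(3) by (simp add: powr_numeral)
  qed
  moreover have "fst R + snd R \<le> log 2 144 + 2 * max (1 - \<delta> / 2) (\<delta> / 2) * log 2 P"
  proof (rule bound)
    show "fst R + snd R \<le> log 2 ((sqrt (2 * exp 1))\<^sup>2 * ((P + P powr \<delta> + 1) * (P powr (1 - \<delta>) + 2)))"
      using b(3) assms(3) by simp
    show "0 < (sqrt (2 * exp 1))\<^sup>2 * ((P + P powr \<delta> + 1) * (P powr (1 - \<delta>) + 2))"
      using assms(3) by (intro mult_pos_pos add_pos_nonneg) auto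
    have "P powr 1 \<le> P powr (max 1 \<delta>)" "P powr \<delta> \<le> P powr (max 1 \<delta>)" "1 \<le> P powr (max 1 \<delta>)"
      "P powr (1 - \<delta>) \<le> P powr (max (1 - \<delta>) 0)" "1 \<le> P powr (max (1 - \<delta>) 0)"
      by (intro mono P1, simp)+
    then have "(P + P powr \<delta> + 1) * (P powr (1 - \<delta>) + 2) \<le> (3 * P powr (max 1 \<delta>)) * (3 * P powr (max (1 - \<delta>) 0))"
      using assms(3) by (intro mult_mono) auto
    moreover have "(sqrt (2 * exp 1))\<^sup>2 \<le> (3::real)\<^sup>2" using C by (intro power_mono) auto
    moreover have "0 \<le> (P + P powr \<delta> + 1) * (P powr (1 - \<delta>) + 2)" using assms(3) by simp
    ultimately have "(sqrt (2 * exp 1))\<^sup>2 * ((P + P powr \<delta> + 1) * (P powr (1 - \<delta>) + 2))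
      \<le> 3\<^sup>2 * ((3 * P powr (max 1 \<delta>)) * (3 * P powr (max (1 - \<delta>) 0)))"
      by - (rule mult_mono, simp_all)
    also have "\<dots> = 81 * P powr (max 1 \<delta> + max (1 - \<delta>) 0)" by (simp add: powr_add)
    \<comment> \<open>Both maxima switch at \<delta> = 1, so they combine into the second term of
      the minimum.\<close>
    also have "max 1 \<delta> + max (1 - \<delta>) 0 = 2 * max (1 - \<delta> / 2) (\<delta> / 2)" by (auto simp: max_def)
    also have "81 * P powr \<dots> \<le> 144 * P powr \<dots>" by (intro mult_right_mono) auto
    finally show "(sqrt (2 * exp 1))\<^sup>2 * ((P + P powr \<delta> + 1) * (P powr (1 - \<delta>) + 2))
      \<le> 144 * P powr (2 * max (1 - \<delta> / 2) (\<delta> / 2))" .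
  qed
  moreover have "fst R + snd R \<le> log 2 144 + 2 * max (1 - \<delta>) \<delta> * log 2 P"
  proof (rule bound)
    show "fst R + snd R \<le> log 2 ((sqrt (2 * exp 1) * (P powr (1 - \<delta>) + P powr \<delta> + 2))\<^sup>2)"
      using b(4) assms(3) by simp
    show "0 < (sqrt (2 * exp 1) * (P powr (1 - \<delta>) + P powr \<delta> + 2))\<^sup>2"
      using assms(3) by (intro zero_less_power mult_pos_pos add_nonneg_pos) auto
    have "P powr (1 - \<delta>) \<le> P powr (max (1 - \<delta>) \<delta>)" "P powr \<delta> \<le> P powr (max (1 - \<delta>) \<delta>)"
      "1 \<le> P powr (max (1 - \<delta>) \<delta>)"
      by (auto intro!: mono P1)
    then have "(sqrt (2 * exp 1) * (P powr (1 - \<delta>) + P powr \<delta> + 2))\<^sup>2 \<le> (3 * (4 * P powr (max (1 - \<delta>) \<delta>)))\<^sup>2"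
      using C assms(3) by (intro power_mono mult_mono) auto
    also have "\<dots> = 144 * P powr (2 * max (1 - \<delta>) \<delta>)"
      by (simp add: power2_eq_square powr_add[symmetric])
    finally show "(sqrt (2 * exp 1) * (P powr (1 - \<delta>) + P powr \<delta> + 2))\<^sup>2 \<le> 144 * P powr (2 * max (1 - \<delta>) \<delta>)" .
  qed
  moreover have "s \<le> k + 2 * min (min a b) c * l"
    if "s \<le> k + 2 * c * l" "s \<le> k + 2 * b * l" "s \<le> k + 2 * a * l" for s k a b c l :: real
    using that by (simp add: min_def)
  ultimately show ?thesis by blast
qed

text \<open>A real \<open>Sup\<close> says something only for a nonempty set that is bounded above.
  \<open>R0\<close> gives the first; the bound \<open>b\<close> gives the second and passes to the
  closure because a half-plane is closed.\<close>

lemma sum_capacity_bounds: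
  assumes le: "\<And>R. achievable h11 h12 h21 h22 a1 a2 A \<sigma> R \<Longrightarrow> fst R + snd R \<le> b"
    and R0: "achievable h11 h12 h21 h22 a1 a2 A \<sigma> R0"
  shows "fst R0 + snd R0 \<le> sum_capacity h11 h12 h21 h22 a1 a2 A \<sigma>"
    and "sum_capacity h11 h12 h21 h22 a1 a2 A \<sigma> \<le> b"
proof -
  let ?G = "capacity_region h11 h12 h21 h22 a1 a2 A \<sigma>"
  have "closed {R :: real \<times> real. fst R + snd R \<le> b}"
    by (intro closed_Collect_le continuous_intros)
  then have "?G \<subseteq> {R. fst R + snd R \<le> b}"
    unfolding capacity_region_def using le by (intro closure_minimal) auto
  then have G: "fst R + snd R \<le> b" if "R \<in> ?G" for R using that by blast
  have R0: "R0 \<in> ?G"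
    unfolding capacity_region_def using R0 by (intro subsetD[OF closure_subset] CollectI)
  show "sum_capacity h11 h12 h21 h22 a1 a2 A \<sigma> \<le> b"
    unfolding sum_capacity_def using R0 G by (intro cSup_least) auto
  show "fst R0 + snd R0 \<le> sum_capacity h11 h12 h21 h22 a1 a2 A \<sigma>"
    unfolding sum_capacity_def using R0 G by (intro cSup_upper bdd_aboveI2) auto
qed

section \<open>Typical noise, grids and random tables\<close>

lemma gaussian_tail_small:
  assumes "0 < \<sigma>" "0 < \<epsilon>"
  obtains \<tau> where "0 < \<tau>" "measure (gaussian 0 \<sigma>) {z. \<tau> < \<bar>z\<bar>} \<le> \<epsilon>"
proof -
  interpret prob_space "gaussian 0 \<sigma>" by (rule prob_space_normal_density) fact
  have "(\<lambda>i. measure (gaussian 0 \<sigma>) {z. real i < \<bar>z\<bar>}) \<longlonglongrightarrow> measure (gaussian 0 \<sigma>) (\<Inter>i. {z. real i < \<bar>z\<bar>})"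
    by (rule finite_Lim_measure_decseq) (auto simp: decseq_def)
  moreover have "(\<Inter>i. {z::real. real i < \<bar>z\<bar>}) = {}"
  proof (intro equals0I)
    fix z assume "z \<in> (\<Inter>i. {z::real. real i < \<bar>z\<bar>})"
    then have "real i < \<bar>z\<bar>" for i by simp
    then show False using reals_Archimedean2[of "\<bar>z\<bar>"] less_asym by blast
  qed
  ultimately have "(\<lambda>i. measure (gaussian 0 \<sigma>) {z. real i < \<bar>z\<bar>}) \<longlonglongrightarrow> 0" by simp
  then have "eventually (\<lambda>i. measure (gaussian 0 \<sigma>) {z. real i < \<bar>z\<bar>} < \<epsilon>) sequentially"
    using assms(2) by (rule order_tendstoD)
  moreover have "eventually (\<lambda>i::nat. 0 < i) sequentially" by (rule eventually_gt_at_top)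
  ultimately have "eventually (\<lambda>i::nat. 0 < i \<and> measure (gaussian 0 \<sigma>) {z. real i < \<bar>z\<bar>} < \<epsilon>) sequentially"
    by eventually_elim simp
  then obtain i :: nat where "0 < i" "measure (gaussian 0 \<sigma>) {z. real i < \<bar>z\<bar>} < \<epsilon>"
    using eventually_happens'[OF sequentially_bot] by blast
  then show thesis using that[of "real i"] by simp
qed

lemma card_subsets_of_card_le: "card {S. S \<subseteq> {..<n::nat} \<and> card S = k} \<le> 2 ^ n"
proof -
  have "card {S. S \<subseteq> {..<n} \<and> card S = k} \<le> card (Pow {..<n})" by (rule card_mono) auto
  then show ?thesis by (simp add: card_Pow)
qed

text \<open>Union bound over the sets of \<open>k\<close> positions, at most 2 ^ n of them;
  independence gives at most \<epsilon> ^ k for each.\<close>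

lemma many_large_noise_unlikely:
  assumes "0 < \<sigma>" "measure (gaussian 0 \<sigma>) {z. \<tau> < \<bar>z\<bar>} \<le> \<epsilon>"
  shows "measure (noise_meas \<sigma> n) {z \<in> space (noise_meas \<sigma> n). k \<le> card {t\<in>{..<n}. \<tau> < \<bar>z t\<bar>}} \<le> 2 ^ n * \<epsilon> ^ k"
proof -
  interpret product_prob_space "\<lambda>_. gaussian 0 \<sigma>" "{..<n}"
    by (rule product_prob_space_gaussian) fact
  interpret noise: prob_space "noise_meas \<sigma> n" by (rule prob_space_noise_meas) fact
  let ?F = "{S. S \<subseteq> {..<n} \<and> card S = k}"
  let ?E = "\<lambda>S. {z \<in> space (noise_meas \<sigma> n). \<forall>t\<in>S. z t \<in> {z. \<tau> < \<bar>z\<bar>}}"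
  have E: "measure (noise_meas \<sigma> n) (?E S) \<le> \<epsilon> ^ k" if "S \<in> ?F" for S
  proof -
    have "emeasure (noise_meas \<sigma> n) (?E S) = (\<Prod>t\<in>S. emeasure (gaussian 0 \<sigma>) {z. \<tau> < \<bar>z\<bar>})"
      unfolding noise_meas_def using that
      by (intro emeasure_PiM_Collect) (auto intro: finite_subset)
    also have "\<dots> = ennreal (measure (gaussian 0 \<sigma>) {z. \<tau> < \<bar>z\<bar>} ^ k)"
      using that by (simp add: M.emeasure_eq_measure ennreal_power)
    finally have "measure (noise_meas \<sigma> n) (?E S) = measure (gaussian 0 \<sigma>) {z. \<tau> < \<bar>z\<bar>} ^ k"
      by (simp add: noise.emeasure_eq_measure)
    then show ?thesis using assms(2) by (simp add: power_mono)
  qed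
  have Em: "?E S \<in> sets (noise_meas \<sigma> n)" if "S \<in> ?F" for S
  proof -
    have "finite S" using that by (auto intro: finite_subset)
    moreover have "{z \<in> space (noise_meas \<sigma> n). z t \<in> {z. \<tau> < \<bar>z\<bar>}} \<in> sets (noise_meas \<sigma> n)" if "t \<in> S" for t
      using that \<open>S \<in> ?F\<close> unfolding noise_meas_def by (intro sets_Collect_single) auto
    ultimately show ?thesis by (intro sets.sets_Collect_finite_All) auto
  qed
  have finF: "finite ?F" by simp
  have "measure (noise_meas \<sigma> n) {z \<in> space (noise_meas \<sigma> n). k \<le> card {t\<in>{..<n}. \<tau> < \<bar>z t\<bar>}}
    \<le> measure (noise_meas \<sigma> n) (\<Union>S\<in>?F. ?E S)"
  proof (rule noise.finite_measure_mono)
    show "(\<Union>S\<in>?F. ?E S) \<in> sets (noise_meas \<sigma> n)"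
      using Em finF by (intro sets.finite_UN) auto
    show "{z \<in> space (noise_meas \<sigma> n). k \<le> card {t\<in>{..<n}. \<tau> < \<bar>z t\<bar>}} \<subseteq> (\<Union>S\<in>?F. ?E S)"
    proof clarify
      fix z assume z: "z \<in> space (noise_meas \<sigma> n)" "k \<le> card {t\<in>{..<n}. \<tau> < \<bar>z t\<bar>}"
      then obtain S where "S \<subseteq> {t\<in>{..<n}. \<tau> < \<bar>z t\<bar>}" "card S = k"
        using obtain_subset_with_card_n by metis
      then show "z \<in> (\<Union>S\<in>?F. ?E S)" using z(1) by blast
    qed
  qed
  also have "\<dots> \<le> (\<Sum>S\<in>?F. measure (noise_meas \<sigma> n) (?E S))"
    using Em finF by (intro noise.finite_measure_subadditive_finite) auto
  also have "\<dots> \<le> (\<Sum>S\<in>?F. \<epsilon> ^ k)" by (intro sum_mono E)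
  also have "\<dots> \<le> 2 ^ n * \<epsilon> ^ k"
  proof -
    have "0 \<le> \<epsilon>" using assms(2) measure_nonneg order_trans by blast
    moreover have "real (card ?F) \<le> 2 ^ n"
      using of_nat_mono[where 'a=real, OF card_subsets_of_card_le[of n k]] by simp
    ultimately show ?thesis by (simp add: mult_right_mono)
  qed
  finally show ?thesis .
qed

lemma card_grid_interval_le:
  fixes b h \<kappa> :: real
  assumes "0 < b" "0 \<le> \<kappa>"
  shows "real (card {v\<in>{..<q::nat}. \<bar>b * real v + h\<bar> \<le> \<kappa>}) \<le> 2 * \<kappa> / b + 1"
proof -
  let ?S = "{v\<in>{..<q}. \<bar>b * real v + h\<bar> \<le> \<kappa>}"
  have "card ?S = card (int ` ?S)" by (simp add: card_image)
  also have "\<dots> \<le> card {\<lceil>(- h - \<kappa>) / b\<rceil>..\<lfloor>(- h + \<kappa>) / b\<rfloor>}"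
    using assms(1)
    by (intro card_mono) (auto simp: ceiling_le_iff le_floor_iff field_simps abs_le_iff)
  also have "\<dots> = nat (\<lfloor>(- h + \<kappa>) / b\<rfloor> - \<lceil>(- h - \<kappa>) / b\<rceil> + 1)" by simp
  finally have "real (card ?S) \<le> real (nat (\<lfloor>(- h + \<kappa>) / b\<rfloor> - \<lceil>(- h - \<kappa>) / b\<rceil> + 1))" by simp
  also have "\<dots> \<le> max 0 ((- h + \<kappa>) / b - (- h - \<kappa>) / b + 1)"
    using of_int_floor_le[of "(- h + \<kappa>) / b"] le_of_int_ceiling[of "(- h - \<kappa>) / b"] by linarith
  also have "(- h + \<kappa>) / b - (- h - \<kappa>) / b = 2 * \<kappa> / b" by (simp add: diff_divide_distrib[symmetric])
  finally show ?thesis using assms by simp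
qed

section \<open>Uniform words and tables\<close>

abbreviation words :: "nat \<Rightarrow> nat \<Rightarrow> (nat \<Rightarrow> nat) set" where
  "words n q \<equiv> {..<n} \<rightarrow>\<^sub>E {..<q}"

lemma card_words: "card (words n q) = q ^ n"
  by (simp add: card_PiE)

text \<open>The same union bound over positions, now with the word as the source of randomness. The
  target may vary with \<open>t\<close>, since the offset at each time comes from the rest of the
  table.\<close>

lemma card_words_many_hits_le:
  assumes "\<And>t. real (card {v\<in>{..<q}. P t v}) \<le> \<rho> * real q" "0 \<le> \<rho>"
  shows "real (card {w\<in>words n q. k \<le> card {t\<in>{..<n}. P t (w t)}}) \<le> 2 ^ n * \<rho> ^ k * real (card (words n q))"
proof -
  let ?F = "{S. S \<subseteq> {..<n} \<and> card S = k}"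
  let ?E = "\<lambda>S. PiE {..<n} (\<lambda>t. if t \<in> S then {v\<in>{..<q}. P t v} else {..<q})"
  have E: "real (card (?E S)) \<le> \<rho> ^ k * real q ^ n" if S: "S \<in> ?F" for S
  proof -
    have "real (card (?E S)) = (\<Prod>t<n. real (card (if t \<in> S then {v\<in>{..<q}. P t v} else {..<q})))"
      by (simp add: card_PiE)
    also have "\<dots> \<le> (\<Prod>t<n. if t \<in> S then \<rho> * real q else real q)"
      using assms by (intro prod_mono) auto
    also have "\<dots> = (\<Prod>t<n. (if t \<in> S then \<rho> else 1) * real q)"
      by (intro prod.cong) auto
    also have "\<dots> = (\<Prod>t<n. if t \<in> S then \<rho> else 1) * real q ^ n"
      by (simp add: prod.distrib)
    also have "(\<Prod>t<n. if t \<in> S then \<rho> else 1) = (\<Prod>t\<in>S. \<rho>)"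
      using S by (subst prod.inter_restrict[symmetric]) (auto simp: Int_absorb1)
    finally show ?thesis using S by simp
  qed
  have "{w\<in>words n q. k \<le> card {t\<in>{..<n}. P t (w t)}} \<subseteq> (\<Union>S\<in>?F. ?E S)"
  proof clarify
    fix w assume w: "w \<in> words n q" "k \<le> card {t\<in>{..<n}. P t (w t)}"
    then obtain S where S: "S \<subseteq> {t\<in>{..<n}. P t (w t)}" "card S = k"
      using obtain_subset_with_card_n by metis
    then have "w \<in> ?E S" using w(1) by (auto simp: PiE_iff)
    then show "w \<in> (\<Union>S\<in>?F. ?E S)" using S by blast
  qed
  then have "card {w\<in>words n q. k \<le> card {t\<in>{..<n}. P t (w t)}} \<le> card (\<Union>S\<in>?F. ?E S)"
    by (intro card_mono) (auto intro!: finite_PiE)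
  also have "\<dots> \<le> (\<Sum>S\<in>?F. card (?E S))" by (intro card_UN_le) simp
  finally have "real (card {w\<in>words n q. k \<le> card {t\<in>{..<n}. P t (w t)}}) \<le> (\<Sum>S\<in>?F. real (card (?E S)))"
    unfolding of_nat_sum[symmetric] by (rule of_nat_mono)
  also have "\<dots> \<le> (\<Sum>S\<in>?F. \<rho> ^ k * real q ^ n)" by (intro sum_mono E)
  also have "\<dots> \<le> 2 ^ n * (\<rho> ^ k * real q ^ n)"
  proof -
    have "real (card ?F) \<le> 2 ^ n"
      using of_nat_mono[where 'a=real, OF card_subsets_of_card_le[of n k]] by simp
    then show ?thesis using assms(2) by (simp add: mult_right_mono)
  qed
  finally show ?thesis by (simp add: card_words mult.assoc)
qed

text \<open>Resampling one row of a uniformly random table leaves the distribution unchanged.\<close>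
lemma card_resample_row_le:
  assumes "finite I" "finite W" "r \<in> I" "W \<noteq> {}"
    and le: "\<And>\<xi>. \<xi> \<in> I \<rightarrow>\<^sub>E W \<Longrightarrow> real (card {w\<in>W. E (\<xi>(r := w))}) \<le> \<beta> * real (card W)"
  shows "real (card {\<xi>\<in>I \<rightarrow>\<^sub>E W. E \<xi>}) \<le> \<beta> * real (card (I \<rightarrow>\<^sub>E W))"
proof -
  let ?\<Omega> = "I \<rightarrow>\<^sub>E W"
  have fin: "finite ?\<Omega>" using assms by (intro finite_PiE) auto
  let ?A = "SIGMA \<xi>:?\<Omega>. {w\<in>W. E (\<xi>(r := w))}" and ?B = "{\<xi>\<in>?\<Omega>. E \<xi>} \<times> W"
  \<comment> \<open>Exchanging row \<open>r\<close> with the fresh word is an involution; it turns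
    tables whose resampled version satisfies \<open>E\<close> into tables that satisfy
    \<open>E\<close> themselves.\<close>
  have "bij_betw (\<lambda>(\<xi>, w). (\<xi>(r := w), \<xi> r)) ?A ?B"
  proof (rule bij_betw_byWitness[where f'="\<lambda>(\<xi>, w). (\<xi>(r := w), \<xi> r)"])
    show "(\<lambda>(\<xi>, w). (\<xi>(r := w), \<xi> r)) ` ?A \<subseteq> ?B" "(\<lambda>(\<xi>, w). (\<xi>(r := w), \<xi> r)) ` ?B \<subseteq> ?A"
      using \<open>r \<in> I\<close> by (auto simp: PiE_iff extensional_def)
  qed auto
  then have "card ?A = card ?B" by (rule bij_betw_same_card)
  then have "real (card {\<xi>\<in>?\<Omega>. E \<xi>}) * real (card W) = (\<Sum>\<xi>\<in>?\<Omega>. real (card {w\<in>W. E (\<xi>(r := w))}))"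
    using fin assms(2) by (simp add: card_SigmaI flip: of_nat_mult of_nat_sum)
  also have "\<dots> \<le> (\<Sum>\<xi>\<in>?\<Omega>. \<beta> * real (card W))" by (intro sum_mono le)
  finally have "real (card {\<xi>\<in>?\<Omega>. E \<xi>}) * real (card W) \<le> (\<beta> * real (card ?\<Omega>)) * real (card W)"
    by (simp add: mult_ac)
  moreover have "0 < real (card W)" using assms by (simp add: card_gt_0_iff)
  ultimately show ?thesis by simp
qed

section \<open>Random superposition codes\<close>

text \<open>\<rho>c, \<rho>p and \<rho>i bound the chance that one uniform symbol of the own coarse
  word, the own detail word or the interfering coarse word hits a given window. The tolerance \<tau>
  + \<sigma> allows \<tau> for the noise and \<sigma> for the unresolved detail of the other user;
  it is doubled because two explanations of the same output are compared.\<close>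

locale random_code =
  fixes \<sigma> g bc bp \<tau> \<epsilon> \<rho>c \<rho>p \<rho>i :: real and n q d Mc Mp M :: nat
  assumes \<sigma>: "0 < \<sigma>" and g: "0 < g" and bp: "0 < bp"
    and noise: "measure (gaussian 0 \<sigma>) {z. \<tau> < \<bar>z\<bar>} \<le> \<epsilon>"
    and detail_weak: "g * bp * real q \<le> \<sigma>"
    and pos: "0 < q" "0 < Mc" "0 < Mp" "0 < M"
    and M: "M \<le> Mc * Mp"
    and hits_c: "\<And>h. real (card {v\<in>{..<q}. \<bar>bc * real v + h\<bar> \<le> 2 * (\<tau> + \<sigma>)}) \<le> \<rho>c * real q"
    and hits_p: "\<And>h. real (card {v\<in>{..<q}. \<bar>bp * real v + h\<bar> \<le> 2 * (\<tau> + \<sigma>)}) \<le> \<rho>p * real q"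
    and hits_i: "\<And>h. real (card {v\<in>{..<q}. \<bar>g * bc * real v + h\<bar> \<le> 2 * (\<tau> + \<sigma>)}) \<le> \<rho>i * real q"
begin

text \<open>Rows are addressed by (user, detail?, index). A codeword superposes a strong coarse row, which both
  receivers have to cope with, and a weak detail row, which the other receiver sees below noise level.\<close>
definition rows :: "(bool \<times> bool \<times> nat) set" where
  "rows = UNIV \<times> ({False} \<times> {..<Mc} \<union> {True} \<times> {..<Mp})"

definition tables :: "(bool \<times> bool \<times> nat \<Rightarrow> nat \<Rightarrow> nat) set" where
  "tables = rows \<rightarrow>\<^sub>E words n q"

text \<open>Messages start at 1, hence the shift; the two digits of \<open>m - 1\<close> in base
  \<open>Mp\<close> choose the two rows.\<close>

definition coarse :: "nat \<Rightarrow> nat" where "coarse m = (m - 1) div Mp"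
definition detail :: "nat \<Rightarrow> nat" where "detail m = (m - 1) mod Mp"

definition codeword :: "(bool \<times> bool \<times> nat \<Rightarrow> nat \<Rightarrow> nat) \<Rightarrow> bool \<Rightarrow> nat \<Rightarrow> nat \<Rightarrow> real" where
  "codeword \<xi> u m t = bc * real (\<xi> (u, False, coarse m) t) + bp * real (\<xi> (u, True, detail m) t)"

definition view :: "(bool \<times> bool \<times> nat \<Rightarrow> nat \<Rightarrow> nat) \<Rightarrow> bool \<Rightarrow> nat \<Rightarrow> nat \<Rightarrow> nat \<Rightarrow> real" where
  "view \<xi> u m l t = codeword \<xi> u m t + g * (bc * real (\<xi> (\<not> u, False, l) t))"

definition consistent where
  "consistent \<xi> u y m l \<longleftrightarrow> card {t\<in>{..<n}. \<tau> + \<sigma> < \<bar>y t - view \<xi> u m l t\<bar>} \<le> d"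

text \<open>With typical noise and no collision exactly one message qualifies; \<open>LEAST\<close>
  settles the remaining cases, which are charged as errors.\<close>

definition decode where
  "decode \<xi> u y = (LEAST m. m \<in> {1..M} \<and> (\<exists>l<Mc. consistent \<xi> u y m l))"

text \<open>Two pairs consistent with one output fail at no more than \<open>d\<close> positions
  each, so their views are close at \<open>n - 2 * d\<close> or more positions. The event depends on
  the table alone, which separates the noise from the random code.\<close>

definition collide where
  "collide \<xi> u m l m' l' \<longleftrightarrow>
     n - 2 * d \<le> card {t\<in>{..<n}. \<bar>view \<xi> u m' l' t - view \<xi> u m l t\<bar> \<le> 2 * (\<tau> + \<sigma>)}"

lemma valid_decoder_decode: "valid_decoder n (decode \<xi> u)"
proof -
  have [measurable]: "Measurable.pred (PiM {..<n} (\<lambda>_. borel)) (\<lambda>y. \<tau> + \<sigma> < \<bar>y t - c\<bar>)" if "t \<in> {..<n}" for t c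
    using that by measurable
  have "{y \<in> space (PiM {..<n} (\<lambda>_. borel)). t \<in> {t\<in>{..<n}. \<tau> + \<sigma> < \<bar>y t - c t\<bar>}}
    \<in> sets (PiM {..<n} (\<lambda>_. borel))" for t c
    by (cases "t \<in> {..<n}") auto
  then have "(\<lambda>y. card {t\<in>{..<n}. \<tau> + \<sigma> < \<bar>y t - c t\<bar>}) \<in> PiM {..<n} (\<lambda>_. borel) \<rightarrow>\<^sub>M count_space UNIV" for c
    by (rule measurable_card)
  then have [measurable]: "Measurable.pred (PiM {..<n} (\<lambda>_. borel)) (\<lambda>y. consistent \<xi> u y m l)" for m l
    unfolding consistent_def by measurable
  show ?thesis unfolding valid_decoder_def decode_def by measurable
qed

lemma coarse_less: "m \<in> {1..M} \<Longrightarrow> coarse m < Mc"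
  unfolding coarse_def using M pos by (intro less_mult_imp_div_less) auto

lemma detail_less: "detail m < Mp"
  unfolding detail_def using pos by simp

lemma coarse_detail_inj:
  assumes "m \<in> {1..M}" "m' \<in> {1..M}" "coarse m = coarse m'" "detail m = detail m'"
  shows "m = m'"
proof -
  have "m - 1 = m' - 1"
    using assms(3,4) unfolding coarse_def detail_def by (metis div_mult_mod_eq)
  then show ?thesis using assms(1,2) by auto
qed

lemma table_row: "\<xi> \<in> tables \<Longrightarrow> r \<in> rows \<Longrightarrow> t < n \<Longrightarrow> \<xi> r t < q"
  unfolding tables_def by (auto simp: PiE_iff)

lemma error_le:
  assumes "\<xi> \<in> tables" "m \<in> {1..M}" "k \<in> {1..M}"
  shows "measure (noise_meas \<sigma> n) {z \<in> space (noise_meas \<sigma> n).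
      decode \<xi> u (\<lambda>t\<in>{..<n}. 1 * codeword \<xi> u m t + g * codeword \<xi> (\<not> u) k t + z t) \<noteq> m}
    \<le> 2 ^ n * \<epsilon> ^ Suc d
      + of_bool (\<exists>m'\<in>{1..M} - {m}. \<exists>l'<Mc. collide \<xi> u m (coarse k) m' l')"
proof (cases "\<exists>m'\<in>{1..M} - {m}. \<exists>l'<Mc. collide \<xi> u m (coarse k) m' l'")
  case True
  interpret noise: prob_space "noise_meas \<sigma> n" by (rule prob_space_noise_meas[OF \<sigma>])
  have "0 \<le> \<epsilon>" using noise measure_nonneg order_trans by blast
  then have "0 \<le> 2 ^ n * \<epsilon> ^ Suc d" by simp
  then show ?thesis using True noise.prob_le_1 by (simp add: add_increasing)
next
  case False
  interpret noise: prob_space "noise_meas \<sigma> n" by (rule prob_space_noise_meas[OF \<sigma>])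
  let ?y = "\<lambda>z. \<lambda>t\<in>{..<n}. 1 * codeword \<xi> u m t + g * codeword \<xi> (\<not> u) k t + z t"
  let ?bad = "{z \<in> space (noise_meas \<sigma> n). Suc d \<le> card {t\<in>{..<n}. \<tau> < \<bar>z t\<bar>}}"
  have good: "decode \<xi> u (?y z) = m" if z: "card {t\<in>{..<n}. \<tau> < \<bar>z t\<bar>} \<le> d" for z
    unfolding decode_def
  proof (rule Least_equality)
    \<comment> \<open>The detail word of the other user is the only part of the signal missing from
      the view, and it stays within \<sigma>.\<close>
    have small: "\<bar>?y z t - view \<xi> u m (coarse k) t\<bar> \<le> \<sigma> + \<bar>z t\<bar>" if "t < n" for t
    proof -
      have "(\<not> u, True, detail k) \<in> rows" using detail_less by (auto simp: rows_def)
      then have "real (\<xi> (\<not> u, True, detail k) t) \<le> real q"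
        using table_row[OF assms(1) _ that] by (simp add: less_imp_le)
      then have "g * bp * real (\<xi> (\<not> u, True, detail k) t) \<le> g * bp * real q"
        using g bp by (intro mult_left_mono) auto
      moreover have "0 \<le> g * bp * real (\<xi> (\<not> u, True, detail k) t)" using g bp by simp
      moreover have "?y z t - view \<xi> u m (coarse k) t = g * bp * real (\<xi> (\<not> u, True, detail k) t) + z t"
        using that by (simp add: view_def codeword_def algebra_simps)
      ultimately show ?thesis using detail_weak by linarith
    qed
    have "{t\<in>{..<n}. \<tau> + \<sigma> < \<bar>?y z t - view \<xi> u m (coarse k) t\<bar>} \<subseteq> {t\<in>{..<n}. \<tau> < \<bar>z t\<bar>}"
      using small by fastforce
    then have "card {t\<in>{..<n}. \<tau> + \<sigma> < \<bar>?y z t - view \<xi> u m (coarse k) t\<bar>} \<le> d"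
      by - (rule order_trans[OF card_mono z], auto)
    then have true: "consistent \<xi> u (?y z) m (coarse k)"
      unfolding consistent_def .
    then show "m \<in> {1..M} \<and> (\<exists>l<Mc. consistent \<xi> u (?y z) m l)"
      using assms(2) coarse_less[OF assms(3)] by blast
    fix m' assume "m' \<in> {1..M} \<and> (\<exists>l<Mc. consistent \<xi> u (?y z) m' l)"
    then obtain l where l: "m' \<in> {1..M}" "l < Mc" "consistent \<xi> u (?y z) m' l" by blast
    let ?B = "{t\<in>{..<n}. \<tau> + \<sigma> < \<bar>?y z t - view \<xi> u m (coarse k) t\<bar>}"
    let ?B' = "{t\<in>{..<n}. \<tau> + \<sigma> < \<bar>?y z t - view \<xi> u m' l t\<bar>}"
    let ?H = "{t\<in>{..<n}. \<bar>view \<xi> u m' l t - view \<xi> u m (coarse k) t\<bar> \<le> 2 * (\<tau> + \<sigma>)}"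
    have "{..<n} - (?B \<union> ?B') \<subseteq> ?H"
    proof
      fix t assume "t \<in> {..<n} - (?B \<union> ?B')"
      then have "t < n" "\<bar>?y z t - view \<xi> u m (coarse k) t\<bar> \<le> \<tau> + \<sigma>" "\<bar>?y z t - view \<xi> u m' l t\<bar> \<le> \<tau> + \<sigma>"
        by auto
      then have "\<bar>view \<xi> u m' l t - view \<xi> u m (coarse k) t\<bar> \<le> 2 * (\<tau> + \<sigma>)"
        using abs_triangle_ineq4[of "?y z t - view \<xi> u m (coarse k) t" "?y z t - view \<xi> u m' l t"]
        by (simp only: diff_diff_eq2 add_diff_cancel_left' diff_add_cancel) (simp add: algebra_simps)
      then show "t \<in> ?H" using \<open>t < n\<close> by simp
    qed
    then have "card ({..<n} - (?B \<union> ?B')) \<le> card ?H" by (intro card_mono) auto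
    moreover have "card {..<n} - card (?B \<union> ?B') \<le> card ({..<n} - (?B \<union> ?B'))"
      by (rule diff_card_le_card_Diff) simp
    moreover have "card (?B \<union> ?B') \<le> card ?B + card ?B'" by (rule card_Un_le)
    moreover have "card ?B \<le> d" "card ?B' \<le> d" using true l(3) unfolding consistent_def by auto
    ultimately have "n - 2 * d \<le> card ?H" unfolding card_lessThan by linarith
    then have "collide \<xi> u m (coarse k) m' l" unfolding collide_def .
    then show "m \<le> m'" using False l by blast
  qed
  have "measure (noise_meas \<sigma> n) {z \<in> space (noise_meas \<sigma> n). decode \<xi> u (?y z) \<noteq> m}
    \<le> measure (noise_meas \<sigma> n) ?bad"
  proof (rule noise.finite_measure_mono)
    show "{z \<in> space (noise_meas \<sigma> n). decode \<xi> u (?y z) \<noteq> m} \<subseteq> ?bad"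
      using good by (auto simp: not_less_eq_eq[symmetric] simp del: One_nat_def)
    have "{z \<in> space (noise_meas \<sigma> n). t \<in> {t\<in>{..<n}. \<tau> < \<bar>z t\<bar>}} \<in> sets (noise_meas \<sigma> n)" for t
    proof (cases "t < n")
      case True
      then have "{z \<in> space (noise_meas \<sigma> n). z t \<in> {z. \<tau> < \<bar>z\<bar>}} \<in> sets (noise_meas \<sigma> n)"
        unfolding noise_meas_def by (intro sets_Collect_single) auto
      then show ?thesis using True by simp
    qed simp
    then have "(\<lambda>z. card {t\<in>{..<n}. \<tau> < \<bar>z t\<bar>}) \<in> noise_meas \<sigma> n \<rightarrow>\<^sub>M count_space UNIV"
      by (rule measurable_card)
    then show "?bad \<in> sets (noise_meas \<sigma> n)" by measurable
  qed
  also have "\<dots> \<le> 2 ^ n * \<epsilon> ^ Suc d"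
    using \<sigma> noise by (rule many_large_noise_unlikely)
  finally show ?thesis by (simp only: False of_bool_eq add_0_right)
qed


text \<open>Row \<open>r\<close> enters the difference of the two views affinely, with an offset
  that does not involve the resampled word; so each position is hit with probability at most \<rho>,
  whatever the rest of the table.\<close>

lemma collide_fraction_le:
  assumes "r \<in> rows"
    and hits: "\<And>h. real (card {v\<in>{..<q}. \<bar>b * real v + h\<bar> \<le> 2 * (\<tau> + \<sigma>)}) \<le> \<rho> * real q"
    and diff: "\<And>\<xi> w t. view (\<xi>(r := w)) u m' l' t - view (\<xi>(r := w)) u m l t = b * real (w t) + h \<xi> t"
  shows "real (card {\<xi>\<in>tables. collide \<xi> u m l m' l'}) \<le> 2 ^ n * \<rho> ^ (n - 2 * d) * real (card tables)"
  unfolding tables_def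
proof (rule card_resample_row_le)
  show "finite rows" unfolding rows_def by simp
  show "finite (words n q)" by (intro finite_PiE) auto
  show "words n q \<noteq> {}" using pos by (auto simp: PiE_eq_empty_iff)
  have "0 \<le> \<rho> * real q" using hits of_nat_0_le_iff order_trans by blast
  then have "0 \<le> \<rho>" using pos by (simp add: zero_le_mult_iff)
  then show "real (card {w\<in>words n q. collide (\<xi>(r := w)) u m l m' l'}) \<le> 2 ^ n * \<rho> ^ (n - 2 * d) * real (card (words n q))" for \<xi>
    unfolding collide_def diff
    by (intro card_words_many_hits_le hits)
qed (use assms in auto)

text \<open>The row to resample is one that the candidate pair uses and the true pair does not.
  Here, and in the two companions for detail and interference, the assumed inequality of indices
  provides it.\<close>

lemma collide_coarse_le:
  assumes "m' \<in> {1..M}" "coarse m' \<noteq> coarse m"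
  shows "real (card {\<xi>\<in>tables. collide \<xi> u m l m' l'}) \<le> 2 ^ n * \<rho>c ^ (n - 2 * d) * real (card tables)"
proof (rule collide_fraction_le[OF _ hits_c])
  show "(u, False, coarse m') \<in> rows" using coarse_less[OF assms(1)] by (simp add: rows_def)
  show "view (\<xi>((u, False, coarse m') := w)) u m' l' t - view (\<xi>((u, False, coarse m') := w)) u m l t
    = bc * real (w t) + (bp * real (\<xi> (u, True, detail m') t) + g * (bc * real (\<xi> (\<not> u, False, l') t)) - view \<xi> u m l t)"
    for \<xi> w t
    using assms(2) by (simp add: view_def codeword_def)
qed

lemma collide_detail_le:
  assumes "coarse m' = coarse m" "detail m' \<noteq> detail m"
  shows "real (card {\<xi>\<in>tables. collide \<xi> u m l m' l'}) \<le> 2 ^ n * \<rho>p ^ (n - 2 * d) * real (card tables)"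
proof (rule collide_fraction_le[OF _ hits_p])
  show "(u, True, detail m') \<in> rows" using detail_less by (simp add: rows_def)
  show "view (\<xi>((u, True, detail m') := w)) u m' l' t - view (\<xi>((u, True, detail m') := w)) u m l t
    = bp * real (w t) + (bc * real (\<xi> (u, False, coarse m') t) + g * (bc * real (\<xi> (\<not> u, False, l') t)) - view \<xi> u m l t)"
    for \<xi> w t
    using assms(2) by (simp add: view_def codeword_def)
qed

lemma collide_interference_le:
  assumes "l' < Mc" "l' \<noteq> l"
  shows "real (card {\<xi>\<in>tables. collide \<xi> u m l m' l'}) \<le> 2 ^ n * \<rho>i ^ (n - 2 * d) * real (card tables)"
proof (rule collide_fraction_le[OF _ hits_i])
  show "(\<not> u, False, l') \<in> rows" using assms(1) by (simp add: rows_def)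
  show "view (\<xi>((\<not> u, False, l') := w)) u m' l' t - view (\<xi>((\<not> u, False, l') := w)) u m l t
    = g * bc * real (w t) + (codeword \<xi> u m' t - view \<xi> u m l t)"
    for \<xi> w t
    using assms(2) by (simp add: view_def codeword_def)
qed

text \<open>The terms are for a right and a wrong interfering coarse word. In the second case either
  of two rows may be resampled, so the smaller bound applies; not the product, since both words
  reach the receiver in a single sum.\<close>

definition confusion :: "real \<Rightarrow> real" where
  "confusion \<rho> = \<rho> ^ (n - 2 * d) + real (Mc - 1) * min \<rho> \<rho>i ^ (n - 2 * d)"

text \<open>Either the own coarse word is wrong, with any detail word, or it is right and the detail
  word is wrong.\<close>

definition collision_bound :: real where
  "collision_bound = 2 ^ n * (real ((Mc - 1) * Mp) * confusion \<rho>c + real (Mp - 1) * confusion \<rho>p)"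

lemma \<rho>_nonneg: "0 \<le> \<rho>c" "0 \<le> \<rho>p" "0 \<le> \<rho>i"
proof -
  have "0 \<le> \<rho>c * real q" "0 \<le> \<rho>p * real q" "0 \<le> \<rho>i * real q"
    using hits_c hits_p hits_i of_nat_0_le_iff order_trans by blast+
  then show "0 \<le> \<rho>c" "0 \<le> \<rho>p" "0 \<le> \<rho>i" using pos by (simp_all add: zero_le_mult_iff)
qed

lemma confusion_nonneg: "0 \<le> \<rho> \<Longrightarrow> 0 \<le> confusion \<rho>"
  using \<rho>_nonneg unfolding confusion_def by simp

lemma sum_collide_le:
  assumes "l < Mc"
    and le: "\<And>l'. real (card {\<xi>\<in>tables. collide \<xi> u m l m' l'}) \<le> 2 ^ n * \<rho> ^ (n - 2 * d) * real (card tables)"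
  shows "(\<Sum>l'<Mc. real (card {\<xi>\<in>tables. collide \<xi> u m l m' l'})) \<le> 2 ^ n * confusion \<rho> * real (card tables)"
proof -
  let ?c = "\<lambda>l'. real (card {\<xi>\<in>tables. collide \<xi> u m l m' l'})"
  have "?c l' \<le> 2 ^ n * min \<rho> \<rho>i ^ (n - 2 * d) * real (card tables)" if "l' \<in> {..<Mc} - {l}" for l'
    using le[of l'] collide_interference_le[of l' l u m m'] that by (auto simp: min_def)
  then have "(\<Sum>l'\<in>{..<Mc} - {l}. ?c l') \<le> (\<Sum>l'\<in>{..<Mc} - {l}. 2 ^ n * min \<rho> \<rho>i ^ (n - 2 * d) * real (card tables))"
    by (rule sum_mono)
  also have "\<dots> = real (Mc - 1) * (2 ^ n * min \<rho> \<rho>i ^ (n - 2 * d) * real (card tables))"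
    using assms(1) by (simp add: card_Diff_singleton)
  finally have "?c l + (\<Sum>l'\<in>{..<Mc} - {l}. ?c l') \<le> 2 ^ n * confusion \<rho> * real (card tables)"
    using le[of l] by (simp add: confusion_def algebra_simps)
  then show ?thesis using assms(1) by (simp add: sum.remove[of "{..<Mc}" l])
qed

lemma card_other_coarse_le:
  assumes "m \<in> {1..M}"
  shows "card {m'\<in>{1..M}. coarse m' \<noteq> coarse m} \<le> (Mc - 1) * Mp"
proof -
  have "card {m'\<in>{1..M}. coarse m' \<noteq> coarse m} \<le> card (({..<Mc} - {coarse m}) \<times> {..<Mp})"
  proof (rule card_inj_on_le)
    show "inj_on (\<lambda>m'. (coarse m', detail m')) {m'\<in>{1..M}. coarse m' \<noteq> coarse m}"
      by (rule inj_onI) (use coarse_detail_inj in blast)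
    show "(\<lambda>m'. (coarse m', detail m')) ` {m'\<in>{1..M}. coarse m' \<noteq> coarse m} \<subseteq> ({..<Mc} - {coarse m}) \<times> {..<Mp}"
      using coarse_less detail_less by auto
  qed simp
  then show ?thesis using coarse_less[OF assms] by (simp add: card_cartesian_product card_Diff_singleton)
qed

lemma card_same_coarse_le:
  assumes "m \<in> {1..M}"
  shows "card {m'\<in>{1..M} - {m}. coarse m' = coarse m} \<le> Mp - 1"
proof -
  have "card {m'\<in>{1..M} - {m}. coarse m' = coarse m} \<le> card ({..<Mp} - {detail m})"
  proof (rule card_inj_on_le)
    show "inj_on detail {m'\<in>{1..M} - {m}. coarse m' = coarse m}"
      by (rule inj_onI) (use coarse_detail_inj in fastforce)
    show "detail ` {m'\<in>{1..M} - {m}. coarse m' = coarse m} \<subseteq> {..<Mp} - {detail m}"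
      using coarse_detail_inj[OF _ assms] detail_less by auto
  qed simp
  then show ?thesis using detail_less by (simp add: card_Diff_singleton)
qed

lemma expected_collisions_le:
  assumes m: "m \<in> {1..M}" and l: "l < Mc"
  shows "(\<Sum>m'\<in>{1..M} - {m}. \<Sum>l'<Mc. real (card {\<xi>\<in>tables. collide \<xi> u m l m' l'}))
    \<le> collision_bound * real (card tables)"
proof -
  let ?s = "\<lambda>m'. \<Sum>l'<Mc. real (card {\<xi>\<in>tables. collide \<xi> u m l m' l'})"
  let ?C = "{m'\<in>{1..M}. coarse m' \<noteq> coarse m}" and ?D = "{m'\<in>{1..M} - {m}. coarse m' = coarse m}"
  have "(\<Sum>m'\<in>{1..M} - {m}. ?s m') = (\<Sum>m'\<in>?C \<union> ?D. ?s m')"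
    by (intro sum.cong) auto
  also have "\<dots> = (\<Sum>m'\<in>?C. ?s m') + (\<Sum>m'\<in>?D. ?s m')"
    by (rule sum.union_disjoint) auto
  also have "\<dots> \<le> (\<Sum>m'\<in>?C. 2 ^ n * confusion \<rho>c * real (card tables))
      + (\<Sum>m'\<in>?D. 2 ^ n * confusion \<rho>p * real (card tables))"
  proof (intro add_mono sum_mono sum_collide_le l)
    show "real (card {\<xi>\<in>tables. collide \<xi> u m l m' l'}) \<le> 2 ^ n * \<rho>c ^ (n - 2 * d) * real (card tables)"
      if "m' \<in> ?C" for m' l'
      using that by (intro collide_coarse_le) auto
    show "real (card {\<xi>\<in>tables. collide \<xi> u m l m' l'}) \<le> 2 ^ n * \<rho>p ^ (n - 2 * d) * real (card tables)"
      if "m' \<in> ?D" for m' l'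
      using that coarse_detail_inj[OF _ m] by (intro collide_detail_le) auto
  qed
  also have "\<dots> = real (card ?C) * (2 ^ n * confusion \<rho>c * real (card tables))
      + real (card ?D) * (2 ^ n * confusion \<rho>p * real (card tables))"
    by simp
  also have "\<dots> \<le> real ((Mc - 1) * Mp) * (2 ^ n * confusion \<rho>c * real (card tables))
      + real (Mp - 1) * (2 ^ n * confusion \<rho>p * real (card tables))"
    using card_other_coarse_le[OF m] card_same_coarse_le[OF m] confusion_nonneg \<rho>_nonneg
    by (intro add_mono mult_right_mono of_nat_mono) auto
  finally show ?thesis by (simp add: collision_bound_def algebra_simps)
qed

definition err :: "bool \<Rightarrow> (bool \<times> bool \<times> nat \<Rightarrow> nat \<Rightarrow> nat) \<Rightarrow> real" where
  "err u \<xi> = err_prob \<sigma> n 1 g M M (codeword \<xi> u) (codeword \<xi> (\<not> u)) (decode \<xi> u)"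

lemma finite_tables: "finite tables"
  unfolding tables_def rows_def by (intro finite_PiE) auto

text \<open>First-moment argument: the indicator that some pair collides is at most the number of
  colliding pairs, whose average is bounded for each pair of sent messages separately.\<close>

lemma sum_err_le: "(\<Sum>\<xi>\<in>tables. err u \<xi>) \<le> (2 ^ n * \<epsilon> ^ Suc d + collision_bound) * real (card tables)"
proof -
  let ?\<nu> = "2 ^ n * \<epsilon> ^ Suc d"
  let ?i = "\<lambda>\<xi> m k. of_bool (\<exists>m'\<in>{1..M} - {m}. \<exists>l'<Mc. collide \<xi> u m (coarse k) m' l') :: real"
  have i: "(\<Sum>\<xi>\<in>tables. ?i \<xi> m k) \<le> collision_bound * real (card tables)"
    if m: "m \<in> {1..M}" and k: "k \<in> {1..M}" for m k
  proof -
    have "?i \<xi> m k \<le> (\<Sum>m'\<in>{1..M} - {m}. \<Sum>l'<Mc. of_bool (collide \<xi> u m (coarse k) m' l'))" for \<xi>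
    proof (cases "\<exists>m'\<in>{1..M} - {m}. \<exists>l'<Mc. collide \<xi> u m (coarse k) m' l'")
      case True
      then obtain m' l' where *: "m' \<in> {1..M} - {m}" "l' < Mc" "collide \<xi> u m (coarse k) m' l'" by blast
      have "(1::real) = of_bool (collide \<xi> u m (coarse k) m' l')" using * by simp
      also have "\<dots> \<le> (\<Sum>l'<Mc. of_bool (collide \<xi> u m (coarse k) m' l'))"
        using * by (intro member_le_sum[where f="\<lambda>l'. of_bool (collide \<xi> u m (coarse k) m' l')"]) auto
      also have "\<dots> \<le> (\<Sum>m'\<in>{1..M} - {m}. \<Sum>l'<Mc. of_bool (collide \<xi> u m (coarse k) m' l'))"
        using * by (intro member_le_sum[where f="\<lambda>m'. \<Sum>l'<Mc. of_bool (collide \<xi> u m (coarse k) m' l')"] sum_nonneg) auto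
      finally show ?thesis by simp
    qed (auto intro!: sum_nonneg)
    then have "(\<Sum>\<xi>\<in>tables. ?i \<xi> m k)
      \<le> (\<Sum>\<xi>\<in>tables. \<Sum>m'\<in>{1..M} - {m}. \<Sum>l'<Mc. of_bool (collide \<xi> u m (coarse k) m' l'))"
      by (rule sum_mono)
    also have "\<dots> = (\<Sum>m'\<in>{1..M} - {m}. \<Sum>l'<Mc. \<Sum>\<xi>\<in>tables. of_bool (collide \<xi> u m (coarse k) m' l'))"
      by (subst sum.swap, intro sum.cong refl, rule sum.swap)
    also have "\<dots> = (\<Sum>m'\<in>{1..M} - {m}. \<Sum>l'<Mc. real (card {\<xi>\<in>tables. collide \<xi> u m (coarse k) m' l'}))"
      using finite_tables by (simp add: sum_of_bool_eq Int_def)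
    also have "\<dots> \<le> collision_bound * real (card tables)"
      using m coarse_less[OF k] by (rule expected_collisions_le)
    finally show ?thesis .
  qed
  have "err u \<xi> \<le> (\<Sum>m\<in>{1..M}. \<Sum>k\<in>{1..M}. ?\<nu> + ?i \<xi> m k) / (real M * real M)" if "\<xi> \<in> tables" for \<xi>
    unfolding err_def err_prob_def using that
    by (intro divide_right_mono sum_mono error_le) auto
  then have "(\<Sum>\<xi>\<in>tables. err u \<xi>) \<le> (\<Sum>\<xi>\<in>tables. (\<Sum>m\<in>{1..M}. \<Sum>k\<in>{1..M}. ?\<nu> + ?i \<xi> m k) / (real M * real M))"
    by (rule sum_mono)
  also have "\<dots> = (\<Sum>\<xi>\<in>tables. \<Sum>m\<in>{1..M}. \<Sum>k\<in>{1..M}. ?\<nu> + ?i \<xi> m k) / (real M * real M)"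
    by (rule sum_divide_distrib[symmetric])
  also have "(\<Sum>\<xi>\<in>tables. \<Sum>m\<in>{1..M}. \<Sum>k\<in>{1..M}. ?\<nu> + ?i \<xi> m k)
    = (\<Sum>m\<in>{1..M}. \<Sum>k\<in>{1..M}. \<Sum>\<xi>\<in>tables. ?\<nu> + ?i \<xi> m k)"
    by (subst sum.swap, intro sum.cong refl, rule sum.swap)
  also have "\<dots> \<le> (\<Sum>m\<in>{1..M}. \<Sum>k\<in>{1..M}. (?\<nu> + collision_bound) * real (card tables))"
  proof (intro sum_mono)
    fix m k assume "m \<in> {1..M}" "k \<in> {1..M}"
    from i[OF this] show "(\<Sum>\<xi>\<in>tables. ?\<nu> + ?i \<xi> m k) \<le> (?\<nu> + collision_bound) * real (card tables)"
      unfolding sum.distrib by (simp add: algebra_simps)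
  qed
  also have "(\<Sum>m\<in>{1..M}. \<Sum>k\<in>{1..M}. (?\<nu> + collision_bound) * real (card tables)) / (real M * real M)
    = (?\<nu> + collision_bound) * real (card tables)"
    using pos by simp
  finally show ?thesis by (simp add: divide_right_mono)
qed

text \<open>The errors of the two receivers are added before averaging, so that one table serves
  both.\<close>

lemma good_table_exists:
  "\<exists>\<xi>\<in>tables. err True \<xi> + err False \<xi> \<le> 2 * (2 ^ n * \<epsilon> ^ Suc d + collision_bound)"
proof (rule ccontr)
  let ?b = "2 * (2 ^ n * \<epsilon> ^ Suc d + collision_bound)"
  assume "\<not> ?thesis"
  then have less: "?b < err True \<xi> + err False \<xi>" if "\<xi> \<in> tables" for \<xi> using that by auto
  have "words n q \<noteq> {}" using pos by (auto simp: PiE_eq_empty_iff)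
  then have "tables \<noteq> {}" by (auto simp: tables_def PiE_eq_empty_iff)
  then have "(\<Sum>\<xi>\<in>tables. ?b) < (\<Sum>\<xi>\<in>tables. err True \<xi> + err False \<xi>)"
    using finite_tables less by (intro sum_strict_mono) auto
  also have "\<dots> \<le> ?b * real (card tables)"
    unfolding sum.distrib using sum_err_le[of True] sum_err_le[of False] by (simp add: algebra_simps)
  finally show False by simp
qed

end

section \<open>Generalized degrees of freedom\<close>

text \<open>The smallness conditions belong to a wrong own coarse word, both coarse words wrong, a
  wrong detail word, and a wrong detail word with wrong interference. Each base must be at most 1/4
  so that the 2 ^ n sets of positions still leave (1/2) ^ n. \<open>Mp\<close> itself, unlike
  \<open>Mp - 1\<close>, suffers from rounding up, hence its separate bound with a factor 2.\<close>

lemma (in random_code) collision_bound_le: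
  assumes counts: "real (Mc - 1) \<le> xc ^ n" "real (Mp - 1) \<le> xp ^ n" "real Mp \<le> 2 * xp' ^ n"
    and fractions: "\<rho>c ^ (n - 2 * d) \<le> r1 ^ n" "min \<rho>c \<rho>i ^ (n - 2 * d) \<le> r2 ^ n"
      "\<rho>p ^ (n - 2 * d) \<le> r3 ^ n" "min \<rho>p \<rho>i ^ (n - 2 * d) \<le> r4 ^ n"
    and nonneg: "0 \<le> xc" "0 \<le> xp" "0 \<le> xp'" "0 \<le> r1" "0 \<le> r2" "0 \<le> r3" "0 \<le> r4"
    and small: "2 * (xc * xp' * r1) \<le> 1/2" "2 * (xc * xp' * (xc * r2)) \<le> 1/2"
      "2 * (xp * r3) \<le> 1/2" "2 * (xp * (xc * r4)) \<le> 1/2"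
  shows "collision_bound \<le> 6 * (1/2) ^ n"
proof -
  have pow: "2 ^ n * x ^ n \<le> (1/2) ^ n" if "0 \<le> x" "2 * x \<le> 1/2" for x :: real
    unfolding power_mult_distrib[symmetric] using that by (intro power_mono) auto
  have \<rho>: "0 \<le> min \<rho>c \<rho>i" "0 \<le> min \<rho>p \<rho>i" using \<rho>_nonneg by auto
  have "confusion \<rho>c \<le> r1 ^ n + xc ^ n * r2 ^ n" "confusion \<rho>p \<le> r3 ^ n + xc ^ n * r4 ^ n"
    unfolding confusion_def using \<rho> nonneg by (intro add_mono mult_mono counts fractions; simp)+
  then have "collision_bound
    \<le> 2 ^ n * (xc ^ n * (2 * xp' ^ n) * (r1 ^ n + xc ^ n * r2 ^ n) + xp ^ n * (r3 ^ n + xc ^ n * r4 ^ n))"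
    unfolding collision_bound_def of_nat_mult using nonneg confusion_nonneg \<rho>_nonneg
    by (intro mult_left_mono add_mono mult_mono counts) auto
  also have "\<dots> = 2 * (2 ^ n * (xc * xp' * r1) ^ n) + 2 * (2 ^ n * (xc * xp' * (xc * r2)) ^ n)
      + 2 ^ n * (xp * r3) ^ n + 2 ^ n * (xp * (xc * r4)) ^ n"
    by (simp add: power_mult_distrib algebra_simps)
  also have "\<dots> \<le> 2 * (1/2) ^ n + 2 * (1/2) ^ n + (1/2) ^ n + (1/2) ^ n"
    using small nonneg by (intro add_mono mult_left_mono pow) auto
  finally show ?thesis by simp
qed

text \<open>Trading the exponent \<open>N\<close> for \<open>n\<close> shrinks x to k x. The cap at
  1 makes the power decreasing in its exponent, and 1 \<le> K gives K powr k \<le> K.\<close>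

lemma hit_fraction_le:
  fixes K P x :: real
  assumes "1 \<le> K" "1 \<le> P" "0 \<le> k" "k \<le> 1" "k * real n \<le> real N"
  shows "min 1 (K / P powr x) ^ N \<le> (K / P powr (k * x)) ^ n"
proof -
  let ?r = "min 1 (K / P powr x)"
  have r: "0 < ?r" "?r \<le> 1" using assms by auto
  have "?r ^ N = ?r powr real N" using r by (simp add: powr_realpow)
  also have "\<dots> \<le> ?r powr (k * real n)" using r assms by (intro powr_mono') auto
  also have "\<dots> \<le> (K / P powr x) powr (k * real n)" using r assms by (intro powr_mono2) auto
  also have "\<dots> = (K powr k / P powr (k * x)) powr real n"
    using assms by (simp add: powr_divide powr_powr mult_ac)
  also have "\<dots> \<le> (K / P powr (k * x)) powr real n"
    using assms powr_mono[of k 1 K] by (intro powr_mono2 divide_right_mono) auto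
  also have "\<dots> = (K / P powr (k * x)) ^ n" using assms by (simp add: powr_realpow)
  finally show ?thesis .
qed

lemma err_prob_nonneg: "0 \<le> err_prob \<sigma> n a b M K f g \<phi>"
  unfolding err_prob_def by (intro divide_nonneg_nonneg sum_nonneg) auto

text \<open>The amplitude of the word is c y. At least \<open>y\<close> grid points make the spacing
  at most \<open>c\<close>, so the boundary term 1 of the interval count is absorbed into q /
  y.\<close>

lemma grid_fraction_le:
  fixes b h \<kappa> K y :: real
  assumes "0 < y" "0 < q" "y \<le> real q" "b * real q = c * y" "0 < c" "0 \<le> \<kappa>" "2 * \<kappa> / c + 1 \<le> K"
  shows "real (card {v\<in>{..<q}. \<bar>b * real v + h\<bar> \<le> \<kappa>}) \<le> min 1 (K / y) * real q"
proof -
  have "card {v\<in>{..<q}. \<bar>b * real v + h\<bar> \<le> \<kappa>} \<le> card {..<q}" by (rule card_mono) auto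
  then have 1: "real (card {v\<in>{..<q}. \<bar>b * real v + h\<bar> \<le> \<kappa>}) \<le> 1 * real q" by simp
  have b: "b = c * y / real q" using assms by (simp add: field_simps)
  then have "0 < b" using assms by simp
  then have "real (card {v\<in>{..<q}. \<bar>b * real v + h\<bar> \<le> \<kappa>}) \<le> 2 * \<kappa> / b + 1"
    using assms by (intro card_grid_interval_le)
  also have "\<dots> = (2 * \<kappa> / c) * (real q / y) + 1" using assms by (simp add: b)
  also have "\<dots> \<le> (2 * \<kappa> / c) * (real q / y) + real q / y" using assms by simp
  also have "\<dots> = (2 * \<kappa> / c + 1) * (real q / y)" by (simp add: algebra_simps)
  also have "\<dots> \<le> K * (real q / y)" using assms by (intro mult_right_mono) auto
  finally have 2: "real (card {v\<in>{..<q}. \<bar>b * real v + h\<bar> \<le> \<kappa>}) \<le> K / y * real q" by simp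
  show ?thesis using 1 2 by (simp add: min_def)
qed

text \<open>The detail part has rate max (1 - delta) 0, the coarse part the remaining rate. The inequalities
  correspond to confusing the own coarse word, both coarse words, and the own detail word together with
  the interfering coarse word.\<close>
lemma gdof_split:
  fixes \<delta> :: real
  defines "\<gamma>p \<equiv> max (1 - \<delta>) 0"
  shows "gdof \<delta> \<le> 1" "2 * gdof \<delta> \<le> \<gamma>p + max 1 \<delta>" "gdof \<delta> \<le> max (1 - \<delta>) \<delta>"
  unfolding \<gamma>p_def by (auto simp: min_def max_def)

lemma achievable_symmetric:
  fixes \<alpha> \<delta> \<sigma> \<eta> :: real
  assumes \<alpha>: "0 < \<alpha>" "\<alpha> \<le> 1" and "0 < \<delta>" and \<sigma>: "0 < \<sigma>" and \<eta>: "0 < \<eta>" "\<eta> < 1/2"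
  obtains c where "\<And>P. 1 \<le> P \<Longrightarrow> achievable 1 (P powr (\<delta> - 1)) (P powr (\<delta> - 1)) 1 \<alpha> \<alpha> (P * \<sigma>) \<sigma>
      ((1 - 2 * \<eta>) * gdof \<delta> * log 2 P - c, (1 - 2 * \<eta>) * gdof \<delta> * log 2 P - c)"
proof -
  \<comment> \<open>Chosen so that \<epsilon> powr (\<eta> n) = (1/4) ^ n, which beats the 2 ^ n
    sets of positions.\<close>
  define \<epsilon> :: real where "\<epsilon> = (1/4) powr (1 / \<eta>)"
  have \<epsilon>: "0 < \<epsilon>" "\<epsilon> \<le> 1" unfolding \<epsilon>_def using \<eta> by (auto intro!: powr_le1)
  obtain \<tau> where \<tau>: "0 < \<tau>" "measure (gaussian 0 \<sigma>) {z. \<tau> < \<bar>z\<bar>} \<le> \<epsilon>"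
    using gaussian_tail_small[OF \<sigma> \<epsilon>(1)] .
  define k where "k = 1 - 2 * \<eta>"
  \<comment> \<open>\<open>K\<close> is the constant of \<open>grid_fraction_le\<close> for the
    window 2 (\<tau> + \<sigma>) and amplitudes in units of \<alpha> \<sigma> / 2; the 4 in
    \<open>C\<close> brings the bases of the union bound to at most 1/4.\<close>
  define K where "K = 2 * (2 * (\<tau> + \<sigma>)) / (\<alpha> * \<sigma> / 2) + 1"
  define C where "C = 4 * K"
  have k: "0 \<le> k" "k \<le> 1" using \<eta> by (auto simp: k_def)
  have K: "1 \<le> K" using \<tau> \<sigma> \<alpha> by (simp add: K_def)
  have C: "1 \<le> C" using K by (simp add: C_def)
  show thesis
  \<comment> \<open>Both parts of the code give up a factor \<open>C ^ n\<close>, hence twice the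
    logarithm.\<close>
  proof (rule that[of "2 * log 2 C"])
    fix P :: real assume P: "1 \<le> P"
    define g where "g = P powr (\<delta> - 1)"
    define A where "A = P * \<sigma>"
    define u where "u x = P powr (k * x)" for x
    define \<gamma>p where "\<gamma>p = max (1 - \<delta>) 0"
    define \<gamma>c where "\<gamma>c = gdof \<delta> - \<gamma>p"
    define R where "R = k * gdof \<delta> * log 2 P - 2 * log 2 C"
    \<comment> \<open>One grid for all words, fine enough for the three strengths that matter: own
      coarse, own detail and interfering coarse.\<close>
    obtain q :: nat where q: "P + P powr (1 - \<delta>) + P powr \<delta> \<le> real q" using real_arch_simple by blast
    \<comment> \<open>Each part gets at most half of \<alpha> A, so every single symbol is at most
      \<alpha> A, which yields the peak and the average constraint together. The detail amplitude is
      such that g times it is \<alpha> \<sigma> / 2.\<close>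
    define bc where "bc = (\<alpha> * \<sigma> / 2) * P / real q"
    define bp where "bp = (\<alpha> * \<sigma> / 2) * P powr (1 - \<delta>) / real q"
    have g: "0 < g" using P by (simp add: g_def)
    have u: "0 < u x" for x using P by (simp add: u_def)
    have u_add: "u x * u y = u (x + y)" for x y by (simp add: u_def powr_add distrib_left)
    have u1: "u x \<le> 1" if "x \<le> 0" for x
      using powr_mono[of "k * x" 0 P] P k that by (simp add: u_def mult_nonneg_nonpos)
    have q0: "0 < q" using q P by (intro gr0I) (use powr_ge_zero[of P] in \<open>smt (verit) of_nat_0\<close>)
    have qs: "P \<le> real q" "P powr (1 - \<delta>) \<le> real q" "P powr \<delta> \<le> real q"
      using q P powr_ge_zero[of P "1 - \<delta>"] powr_ge_zero[of P \<delta>] by linarith+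
    have gP: "g * P = P powr \<delta>" using P by (simp add: g_def powr_diff)
    have gPp: "g * P powr (1 - \<delta>) = 1" using P by (simp add: g_def powr_add[symmetric])
    have bcq: "bc * real q = (\<alpha> * \<sigma> / 2) * P" "bp * real q = (\<alpha> * \<sigma> / 2) * P powr (1 - \<delta>)"
      using q0 by (auto simp: bc_def bp_def)
    have b0: "0 < bc" "0 < bp" using \<alpha> \<sigma> P q0 by (auto simp: bc_def bp_def)
    have "\<exists>f1 f2 \<phi>1 \<phi>2. valid_encoder A \<alpha> n (msg_num R n) f1 \<and> valid_encoder A \<alpha> n (msg_num R n) f2
        \<and> valid_decoder n \<phi>1 \<and> valid_decoder n \<phi>2
        \<and> err_prob \<sigma> n 1 g (msg_num R n) (msg_num R n) f1 f2 \<phi>1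
          + err_prob \<sigma> n 1 g (msg_num R n) (msg_num R n) f2 f1 \<phi>2 \<le> 14 * (1/2) ^ n" for n
    proof -
      define d where "d = nat \<lfloor>\<eta> * real n\<rfloor>"
      define M where "M = msg_num R n"
      define Mc where "Mc = nat \<lceil>(u \<gamma>c / C) ^ n\<rceil>"
      define Mp where "Mp = nat \<lceil>(u \<gamma>p / C) ^ n\<rceil>"
      have x: "0 < (u \<gamma>c / C) ^ n" "0 < (u \<gamma>p / C) ^ n" using u C by auto
      \<comment> \<open>Rounding up adds less than 1, so the numbers of wrong words obey the bound
        even when it is below 1.\<close>
      have Mc: "(u \<gamma>c / C) ^ n \<le> real Mc" "real (Mc - 1) \<le> (u \<gamma>c / C) ^ n" "0 < Mc"
        using x(1) unfolding Mc_def by linarith+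
      have Mp: "(u \<gamma>p / C) ^ n \<le> real Mp" "real (Mp - 1) \<le> (u \<gamma>p / C) ^ n" "0 < Mp"
        using x(2) unfolding Mp_def by linarith+
      have Mp': "real Mp \<le> 2 * u \<gamma>p ^ n"
      proof -
        have "1 \<le> u \<gamma>p" unfolding u_def using P k by (intro ge_one_powr_ge_zero) (auto simp: \<gamma>p_def)
        then have "1 \<le> u \<gamma>p ^ n" by (rule one_le_power)
        moreover have "(u \<gamma>p / C) ^ n \<le> u \<gamma>p ^ n"
          using u[of \<gamma>p] C by (intro power_mono) (auto simp: divide_le_eq)
        ultimately show ?thesis using Mp(2,3) by linarith
      qed
      have M_le: "M \<le> Mc * Mp"
      proof -
        have "2 powr R = u (gdof \<delta>) / C\<^sup>2"
        proof -
          have "2 powr R = 2 powr (log 2 P * (k * gdof \<delta>)) / 2 powr (log 2 C * 2)"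
            unfolding R_def powr_diff by (simp add: mult_ac)
          also have "\<dots> = u (gdof \<delta>) / C\<^sup>2"
            unfolding powr_powr[symmetric] using P C by (simp add: u_def powr_numeral) (simp add: powr_powr)
          finally show ?thesis .
        qed
        moreover have "2 powr (real n * R) = (2 powr R) ^ n"
          by (simp add: powr_powr[symmetric] powr_realpow[symmetric] mult.commute)
        ultimately have "2 powr (real n * R) = (u \<gamma>c / C) ^ n * (u \<gamma>p / C) ^ n"
          by (simp add: power_mult_distrib[symmetric] u_add \<gamma>c_def power2_eq_square)
        also have "\<dots> \<le> real Mc * real Mp" using x Mc(1) Mp(1) by (intro mult_mono) auto
        finally have "2 powr (real n * R) \<le> real (Mc * Mp)" by simp
        then show ?thesis unfolding M_def msg_num_def by (simp add: nat_le_iff ceiling_le_iff)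
      qed
      have d: "real d \<le> \<eta> * real n" "\<eta> * real n \<le> real (Suc d)"
        using \<eta> by (auto simp: d_def) linarith
      have N: "k * real n \<le> real (n - 2 * d)"
        using d(1) by (simp add: k_def algebra_simps)
      interpret random_code \<sigma> g bc bp \<tau> \<epsilon> "min 1 (K / P)" "min 1 (K / P powr (1 - \<delta>))" "min 1 (K / P powr \<delta>)" n q d Mc Mp M
      proof unfold_locales
        have "g * bp * real q = g * (bp * real q)" by simp
        also have "\<dots> = \<alpha> * \<sigma> / 2 * (g * P powr (1 - \<delta>))" unfolding bcq by simp
        also have "\<dots> = \<alpha> * \<sigma> / 2" unfolding gPp by simp
        also have "\<dots> \<le> \<sigma>" using \<alpha> \<sigma> by (simp add: mult_left_le_one_le)
        finally show "g * bp * real q \<le> \<sigma>" .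
        have *: "0 < \<alpha> * \<sigma> / 2" "0 \<le> 2 * (\<tau> + \<sigma>)" "2 * (2 * (\<tau> + \<sigma>)) / (\<alpha> * \<sigma> / 2) + 1 \<le> K"
          using \<alpha> \<sigma> \<tau> by (auto simp: K_def)
        show "real (card {v\<in>{..<q}. \<bar>bc * real v + h\<bar> \<le> 2 * (\<tau> + \<sigma>)}) \<le> min 1 (K / P) * real q" for h
          using P q0 qs bcq by (intro grid_fraction_le[OF _ _ _ _ *]) auto
        show "real (card {v\<in>{..<q}. \<bar>bp * real v + h\<bar> \<le> 2 * (\<tau> + \<sigma>)}) \<le> min 1 (K / P powr (1 - \<delta>)) * real q" for h
          using P q0 qs bcq by (intro grid_fraction_le[OF _ _ _ _ *]) auto
        have "g * bc * real q = g * (bc * real q)" by simp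
        also have "\<dots> = \<alpha> * \<sigma> / 2 * (g * P)" unfolding bcq by simp
        finally have "g * bc * real q = \<alpha> * \<sigma> / 2 * P powr \<delta>" unfolding gP .
        then show "real (card {v\<in>{..<q}. \<bar>g * bc * real v + h\<bar> \<le> 2 * (\<tau> + \<sigma>)}) \<le> min 1 (K / P powr \<delta>) * real q" for h
          using P q0 qs by (intro grid_fraction_le[OF _ _ _ _ *]) auto
        show "0 < M" unfolding M_def by (rule msg_num_pos)
      qed (use \<sigma> g b0 \<tau> q0 Mc Mp M_le in auto)
      have frac: "min 1 (K / P powr x) ^ (n - 2 * d) \<le> (K / u x) ^ n" for x
        unfolding u_def using K P k N by (rule hit_fraction_le)
      have frac1: "min 1 (K / P) ^ (n - 2 * d) \<le> (K / u 1) ^ n"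
        using frac[of 1] P by simp
      have K0: "0 \<le> K" using K by simp
      have frac2: "min (min 1 (K / P powr x)) (min 1 (K / P powr y)) ^ (n - 2 * d) \<le> (K / u (max x y)) ^ n" for x y
      proof -
        have le: "min (min 1 (K / P powr x)) (min 1 (K / P powr y)) ^ (n - 2 * d) \<le> min 1 (K / P powr z) ^ (n - 2 * d)"
          if "z = x \<or> z = y" for z
          using that K0 by (intro power_mono) auto
        have "max x y = x \<or> max x y = y" by (simp add: max_def)
        from le[OF this] frac show ?thesis by (rule order_trans)
      qed
      have bound: "collision_bound \<le> 6 * (1/2) ^ n"
      proof (rule collision_bound_le[OF Mc(2) Mp(2) Mp' frac1])
        show "min (min 1 (K / P)) (min 1 (K / P powr \<delta>)) ^ (n - 2 * d) \<le> (K / u (max 1 \<delta>)) ^ n"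
          using frac2[of 1 \<delta>] P by simp
        \<comment> \<open>For \<delta> > 1 the cap 1 is itself the bound: it is the hit fraction for
          exponent 0, since 1 \<le> K.\<close>
        show "min 1 (K / P powr (1 - \<delta>)) ^ (n - 2 * d) \<le> (K / u \<gamma>p) ^ n"
          using frac2[of "1 - \<delta>" 0] K P by (simp add: \<gamma>p_def min_absorb1)
        show "min (min 1 (K / P powr (1 - \<delta>))) (min 1 (K / P powr \<delta>)) ^ (n - 2 * d) \<le> (K / u (max (1 - \<delta>) \<delta>)) ^ n"
          by (rule frac2)
        have u_diff: "u (x - y) = u x / u y" for x y by (simp add: u_def right_diff_distrib powr_diff)
        have KC: "2 * (K / C * w) \<le> 1/2" if "w \<le> 1" for w
          using that K by (simp add: C_def)
        have KC2: "2 * (K / C * (w / C)) \<le> 1/2" if "w \<le> 1" for w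
          using that C by (intro KC) (auto simp: divide_le_eq)
        have "u (\<gamma>c + \<gamma>p - 1) \<le> 1" using gdof_split(1)[of \<delta>] by (intro u1) (simp add: \<gamma>c_def)
        from KC[OF this] show "2 * (u \<gamma>c / C * u \<gamma>p * (K / u 1)) \<le> 1/2"
          unfolding u_diff u_add[symmetric] by (simp add: ac_simps)
        have "u (\<gamma>c + \<gamma>p + \<gamma>c - max 1 \<delta>) \<le> 1"
          using gdof_split(2)[of \<delta>] unfolding \<gamma>p_def[symmetric]
          by (intro u1) (simp add: \<gamma>c_def)
        from KC2[OF this] show "2 * (u \<gamma>c / C * u \<gamma>p * (u \<gamma>c / C * (K / u (max 1 \<delta>)))) \<le> 1/2"
          unfolding u_diff u_add[symmetric] by (simp add: ac_simps)
        show "2 * (u \<gamma>p / C * (K / u \<gamma>p)) \<le> 1/2"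
          using KC[of 1] u[of \<gamma>p] by simp
        have "u (\<gamma>c + \<gamma>p - max (1 - \<delta>) \<delta>) \<le> 1"
          using gdof_split(3)[of \<delta>] by (intro u1) (simp add: \<gamma>c_def)
        from KC2[OF this] show "2 * (u \<gamma>p / C * (u \<gamma>c / C * (K / u (max (1 - \<delta>) \<delta>)))) \<le> 1/2"
          unfolding u_diff u_add[symmetric] by (simp add: ac_simps)
      qed (use u K0 C in \<open>auto simp: less_imp_le\<close>)
      have "2 ^ n * \<epsilon> ^ Suc d \<le> (1/2) ^ n"
      proof -
        have "\<epsilon> ^ Suc d = \<epsilon> powr real (Suc d)" using \<epsilon> by (simp add: powr_realpow del: of_nat_Suc power_Suc)
        also have "\<dots> \<le> \<epsilon> powr (\<eta> * real n)" using \<epsilon> d(2) by (intro powr_mono') auto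
        also have "\<dots> = (1/4) ^ n" unfolding \<epsilon>_def powr_powr using \<eta> by (simp add: powr_realpow)
        finally have "2 ^ n * \<epsilon> ^ Suc d \<le> 2 ^ n * (1/4) ^ n" by (intro mult_left_mono) auto
        then show ?thesis by (simp add: power_mult_distrib[symmetric])
      qed
      \<comment> \<open>14 = 2 * (1 + 6): twice the sum of the noise and collision bounds.\<close>
      then obtain \<xi> where \<xi>: "\<xi> \<in> tables" "err True \<xi> + err False \<xi> \<le> 14 * (1/2) ^ n"
        using good_table_exists bound by fastforce
      have enc: "valid_encoder A \<alpha> n M (codeword \<xi> v)" for v
      proof -
        have cw: "0 \<le> codeword \<xi> v m t \<and> codeword \<xi> v m t \<le> \<alpha> * A" if "m \<in> {1..M}" "t < n" for m t
        proof -
          have "(v, False, coarse m) \<in> rows" "(v, True, detail m) \<in> rows"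
            using coarse_less[OF that(1)] detail_less by (auto simp: rows_def)
          then have "real (\<xi> (v, False, coarse m) t) \<le> real q" "real (\<xi> (v, True, detail m) t) \<le> real q"
            using table_row[OF \<xi>(1) _ that(2)] by (auto intro: less_imp_le)
          then have "codeword \<xi> v m t \<le> bc * real q + bp * real q"
            unfolding codeword_def using b0 by (intro add_mono mult_left_mono) auto
          also have "\<dots> \<le> (\<alpha> * \<sigma> / 2) * P + (\<alpha> * \<sigma> / 2) * P"
            unfolding bcq using \<alpha> \<sigma> P \<open>0 < \<delta>\<close> powr_mono[of "1 - \<delta>" 1 P]
            by (intro add_mono mult_left_mono) auto
          also have "\<dots> = \<alpha> * A" by (simp add: A_def)
          finally show ?thesis unfolding codeword_def using b0 by simp
        qed
        have "\<alpha> * A \<le> A" using \<alpha> \<sigma> P by (simp add: A_def mult_left_le_one_le)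
        moreover have "(\<Sum>t<n. codeword \<xi> v m t) \<le> real n * (\<alpha> * A)" if "m \<in> {1..M}" for m
          using sum_bounded_above[of "{..<n}" "codeword \<xi> v m" "\<alpha> * A"] cw[OF that] by simp
        ultimately show ?thesis unfolding valid_encoder_def using cw by force
      qed
      have "err_prob \<sigma> n 1 g M M (codeword \<xi> True) (codeword \<xi> False) (decode \<xi> True)
        + err_prob \<sigma> n 1 g M M (codeword \<xi> False) (codeword \<xi> True) (decode \<xi> False) \<le> 14 * (1/2) ^ n"
        using \<xi>(2) unfolding err_def by simp
      then show ?thesis
        unfolding M_def[symmetric] using enc valid_decoder_decode by blast
    qed
    then obtain f1 f2 \<phi>1 \<phi>2 where f:
      "\<And>n. valid_encoder A \<alpha> n (msg_num R n) (f1 n)" "\<And>n. valid_encoder A \<alpha> n (msg_num R n) (f2 n)"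
      "\<And>n. valid_decoder n (\<phi>1 n)" "\<And>n. valid_decoder n (\<phi>2 n)"
      "\<And>n. err_prob \<sigma> n 1 g (msg_num R n) (msg_num R n) (f1 n) (f2 n) (\<phi>1 n)
          + err_prob \<sigma> n 1 g (msg_num R n) (msg_num R n) (f2 n) (f1 n) (\<phi>2 n) \<le> 14 * (1/2) ^ n"
      by metis
    have lim: "(\<lambda>n. 14 * (1/2) ^ n :: real) \<longlonglongrightarrow> 0"
      by (intro tendsto_mult_right_zero LIMSEQ_realpow_zero) auto
    have "(\<lambda>n. err_prob \<sigma> n 1 g (msg_num R n) (msg_num R n) (f1 n) (f2 n) (\<phi>1 n)) \<longlonglongrightarrow> 0"
      "(\<lambda>n. err_prob \<sigma> n 1 g (msg_num R n) (msg_num R n) (f2 n) (f1 n) (\<phi>2 n)) \<longlonglongrightarrow> 0"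
      using f(5) err_prob_nonneg
      by (intro tendsto_sandwich[OF _ _ tendsto_const lim] always_eventually allI;
          smt (verit, best))+
    then show "achievable 1 (P powr (\<delta> - 1)) (P powr (\<delta> - 1)) 1 \<alpha> \<alpha> (P * \<sigma>) \<sigma>
      ((1 - 2 * \<eta>) * gdof \<delta> * log 2 P - 2 * log 2 C, (1 - 2 * \<eta>) * gdof \<delta> * log 2 P - 2 * log 2 C)"
      unfolding achievable_def fst_conv snd_conv g_def[symmetric] A_def[symmetric]
        k_def[symmetric] R_def[symmetric]
      using f(1-4) by blast
  qed
qed

theorem theorem7:
  fixes \<alpha> \<delta> \<sigma> :: real
  assumes "0 < \<alpha>" and "\<alpha> \<le> 1" and "0 < \<delta>" and "0 < \<sigma>"
  shows "((\<lambda>A. sum_capacity 1 ((A / \<sigma>) powr (\<delta> - 1)) ((A / \<sigma>) powr (\<delta> - 1)) 1 \<alpha> \<alpha> A \<sigma>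
                / (2 * log 2 (A / \<sigma>)))
          \<longlongrightarrow> min (min (max (1 - \<delta>) \<delta>) (max (1 - \<delta> / 2) (\<delta> / 2))) 1) at_top"
proof (rule tendstoI)
  let ?S = "\<lambda>A. sum_capacity 1 ((A / \<sigma>) powr (\<delta> - 1)) ((A / \<sigma>) powr (\<delta> - 1)) 1 \<alpha> \<alpha> A \<sigma>"
  let ?L = "\<lambda>A. log 2 (A / \<sigma>)"
  have close: "dist (s / (2 * l)) G < e"
    if "b < e / 4 * l" "\<bar>c\<bar> < e / 4 * l" "2 * \<eta> * G * l \<le> e / 4 * l"
      "s \<le> b + 2 * G * l" "2 * ((1 - 2 * \<eta>) * G * l - c) \<le> s" "0 < e" "0 < l"
    for s G l e b c \<eta> :: real
  proof -
    have "2 * ((1 - 2 * \<eta>) * G * l - c) = 2 * G * l - 2 * (2 * \<eta> * G * l) - 2 * c"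
      by (simp add: algebra_simps)
    moreover have "0 < e * l" using that by simp
    ultimately have "\<bar>s - 2 * G * l\<bar> < e * (2 * l)" using that(1-5) by (simp add: abs_less_iff)
    moreover have "s / (2 * l) - G = (s - 2 * G * l) / (2 * l)" using that by (simp add: field_simps)
    ultimately show ?thesis using that by (simp add: dist_real_def abs_divide divide_less_eq)
  qed
  fix e :: real assume "0 < e"
  \<comment> \<open>\<eta> is fixed before \<open>A\<close> grows because \<open>c\<close> depends
    on it. With \<eta> \<le> e / 8 and \<open>gdof \<delta>\<close> at most 1, the relative loss 2
    \<eta> fits into one share e / 4.\<close>
  define \<eta> where "\<eta> = min (e / 8) (1 / 4)"
  have \<eta>: "0 < \<eta>" "\<eta> < 1/2" "2 * \<eta> \<le> e / 4" using \<open>0 < e\<close> by (auto simp: \<eta>_def)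
  obtain c where c: "\<And>P. 1 \<le> P \<Longrightarrow> achievable 1 (P powr (\<delta> - 1)) (P powr (\<delta> - 1)) 1 \<alpha> \<alpha> (P * \<sigma>) \<sigma>
      ((1 - 2 * \<eta>) * gdof \<delta> * log 2 P - c, (1 - 2 * \<eta>) * gdof \<delta> * log 2 P - c)"
    using achievable_symmetric[OF assms \<eta>(1,2)] by blast
  have "filterlim (\<lambda>A. 1 / \<sigma> * A) at_top at_top"
    using assms(4) by (intro filterlim_tendsto_pos_mult_at_top[OF tendsto_const] filterlim_ident) auto
  then have P: "filterlim (\<lambda>A. A / \<sigma>) at_top at_top" by simp
  have "filterlim (\<lambda>A. 1 / ln 2 * ln (A / \<sigma>)) at_top at_top"
    by (intro filterlim_tendsto_pos_mult_at_top[OF tendsto_const] filterlim_compose[OF ln_at_top P]) auto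
  then have L: "filterlim ?L at_top at_top" by (simp add: log_def)
  have "eventually (\<lambda>A. 1 \<le> A / \<sigma>) at_top" "eventually (\<lambda>A. 4 * \<bar>c\<bar> / e < ?L A) at_top"
    "eventually (\<lambda>A. 4 * log 2 144 / e < ?L A) at_top" "eventually (\<lambda>A. 0 < ?L A) at_top"
    using P L filterlim_at_top_dense[of ?L] by (simp_all add: filterlim_at_top[of "\<lambda>A. A / \<sigma>"])
  then show "eventually (\<lambda>A. dist (?S A / (2 * ?L A)) (gdof \<delta>) < e) at_top"
  proof eventually_elim
    case (elim A)
    have "A = A / \<sigma> * \<sigma>" using assms(4) by simp
    then have ach: "achievable 1 ((A / \<sigma>) powr (\<delta> - 1)) ((A / \<sigma>) powr (\<delta> - 1)) 1 \<alpha> \<alpha> A \<sigma>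
        ((1 - 2 * \<eta>) * gdof \<delta> * ?L A - c, (1 - 2 * \<eta>) * gdof \<delta> * ?L A - c)"
      using c[OF elim(1)] by simp
    note bounds = sum_capacity_bounds[OF achievable_sum_le[OF assms(4) elim(1), of \<delta> \<alpha> \<alpha>] ach]
    have upper: "?S A \<le> log 2 144 + 2 * gdof \<delta> * ?L A" by (rule bounds(2))
    have lower: "2 * ((1 - 2 * \<eta>) * gdof \<delta> * ?L A - c) \<le> ?S A"
      unfolding mult_2[of "_ - c"] using bounds(1) unfolding fst_conv snd_conv .
    have "log 2 144 < e / 4 * ?L A" "\<bar>c\<bar> < e / 4 * ?L A"
      using elim \<open>0 < e\<close> by (auto simp: field_simps)
    moreover have "2 * \<eta> * gdof \<delta> * ?L A \<le> e / 4 * ?L A"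
    proof -
      have "2 * \<eta> * gdof \<delta> \<le> e / 4 * 1"
        using \<eta> gdof_split(1)[of \<delta>] by (intro mult_mono) (auto simp: min_def max_def)
      then show ?thesis using elim(4) by (intro mult_right_mono) auto
    qed
    ultimately show ?case
      using upper lower \<open>0 < e\<close> elim(4) by (intro close)
  qed
qed

end
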